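(* Let $(C,\triangle)$ be an associative coalgebra, $(M,\triangle^l,\triangle^r)$ a bicomodule over it, and $T:C\to M$ a relative Rota-Baxter operator. Equip $M$ with the induced dendriform coalgebra structure $\triangle_\prec=(\mathrm{id}\otimes T)\circ\triangle^r$, $\triangle_\succ=(T\otimes\mathrm{id})\circ\triangle^l$. Then the collection of maps $\Theta_n:\mathrm{Hom}(C,M^{\otimes n})\to\mathrm{Hom}(\mathbb K[C_{n+1}]\otimes M,M^{\otimes(n+1)})$, $n\ge1$, defined by $$\Theta_n(f)_{[r]}=\begin{cases}(-1)^{n+1}(\mathrm{id}\otimes f)\circ\triangle^r&r=1,\\0&2\le r\le n,\\(f\otimes\mathrm{id})\circ\triangle^l&r=n+1,\end{cases}$$ induces a morphism $\Theta_*:H^\bullet_T(C,M)\to H^{\bullet+1}_{\mathrm{coDend}}(M,M)$ from the cohomology of the relative Rota-Baxter operator $T$ to the cohomology of the induced dendriform coalgebra structure on $M$ (with coefficients in itself).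
   Context: All vector spaces, linear maps and tensor products are over a field $\mathbb K$ of characteristic zero. An associative coalgebra $(C,\triangle)$ is a vector space with a linear map $\triangle:C\to C\otimes C$ satisfying $(\triangle\otimes\mathrm{id})\triangle=(\mathrm{id}\otimes\triangle)\triangle$. A bicomodule over it is a vector space $M$ with linear maps $\triangle^l:M\to C\otimes M$, $\triangle^r:M\to M\otimes C$ satisfying $(\triangle\otimes\mathrm{id})\triangle^l=(\mathrm{id}\otimes\triangle^l)\triangle^l$, $(\triangle^l\otimes\mathrm{id})\triangle^r=(\mathrm{id}\otimes\triangle^r)\triangle^l$, $(\triangle^r\otimes\mathrm{id})\triangle^r=(\mathrm{id}\otimes\triangle)\triangle^r$. A linear map $T:C\to M$ is a relative Rota-Baxter operator if $(T\otimes T)\circ\triangle=(\mathrm{id}\otimes T)\circ\triangle^r\circ T+(T\otimes\mathrm{id})\circ\triangle^l\circ T$. In that case $(M,\triangle_\prec,\triangle_\succ)$ with $\triangle_\prec=(\mathrm{id}\otimes T)\triangle^r$, $\triangle_\succ=(T\otimes\mathrm{id})\triangle^l$ is a dendriform coalgebra, i.e. $(\triangle_\prec\otimes\mathrm{id})\triangle_\prec=(\mathrm{id}\otimes(\triangle_\prec+\triangle_\succ))\triangle_\prec$, $(\triangle_\succ\otimes\mathrm{id})\triangle_\prec=(\mathrm{id}\otimes\triangle_\prec)\triangle_\succ$, $((\triangle_\prec+\triangle_\succ)\otimes\mathrm{id})\triangle_\succ=(\mathrm{id}\otimes\triangle_\succ)\triangle_\succ$. Cohomology of $T$. $H^\bullet_T(C,M)$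 is the cohomology of $\bigoplus_{n\ge1}\mathrm{Hom}(C,M^{\otimes n})$ (zero in degree $0$; $\mathrm{Hom}(C,M^{\otimes n})$ in degree $n$) with the differential $d_Tf=(-1)^n\delta f$ for $f\in\mathrm{Hom}(C,M^{\otimes n})$, where $$\delta f=(\mathrm{id}\otimes f)\circ(T\otimes\mathrm{id})\circ\triangle-(\mathrm{id}\otimes f)\circ\triangle^r\circ T+\sum_{i=1}^n(-1)^i\big(\mathrm{id}_{M^{\otimes(i-1)}}\otimes((\mathrm{id}\otimes T)\circ\triangle^r+(T\otimes\mathrm{id})\circ\triangle^l)\otimes\mathrm{id}_{M^{\otimes(n-i)}}\big)\circ f$$ $$+(-1)^{n+1}(f\otimes\mathrm{id})\circ(\mathrm{id}\otimes T)\circ\triangle-(-1)^{n+1}(f\otimes\mathrm{id})\circ\triangle^l\circ T.$$ Dendriform coalgebra cohomology. $C_n=\{[1],\dots,[n]\}$ and $\mathbb K[C_n]$ is the vector space with basis $C_n$. For $m,n\ge1$, $1\le i\le m$ define $R_0^{m,i,n}:C_{m+n-1}\to C_m$ by $[r]\mapsto[r]$ if $r\le i-1$, $[r]\mapsto[i]$ if $i\le r\le i+n-1$, $[r]\mapsto[r-n+1]$ if $i+n\le r\le m+n-1$; and $R_1^{m,i,n}:C_{m+n-1}\to\mathbb K[C_n]$ by $[r]\mapsto[r-i+1]$ if $i\le r\le i+n-1$ and $[r]\mapsto[1]+\cdots+[n]$ otherwise. For $\sigma\in\mathrm{Hom}(\mathbb K[C_n]\otimes X,Y)$ and $x\in\mathbb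 K[C_n]$ write $\sigma_x=\sigma(x;-):X\to Y$ (linear in $x$). For a dendriform coalgebra $(M,\triangle_\prec,\triangle_\succ)$ put $\triangle_{[1]}=\triangle_\prec$, $\triangle_{[2]}=\triangle_\succ$, extended linearly to $\mathbb K[C_2]$. $H^\bullet_{\mathrm{coDend}}(M,M)$ is the cohomology of $C^0=0$, $C^n=\mathrm{Hom}(\mathbb K[C_n]\otimes M,M^{\otimes n})$ ($n\ge1$) with, for $[r]\in C_{n+1}$, $$(\delta_c\sigma)_{[r]}=(\mathrm{id}\otimes\sigma_{R_1^{2,2,n}[r]})\circ\triangle_{R_0^{2,2,n}[r]}+\sum_{i=1}^n(-1)^i(\mathrm{id}^{\otimes(i-1)}\otimes\triangle_{R_1^{n,i,2}[r]}\otimes\mathrm{id}^{\otimes(n-i)})\circ\sigma_{R_0^{n,i,2}[r]}+(-1)^{n+1}(\sigma_{R_1^{2,1,n}[r]}\otimes\mathrm{id})\circ\triangle_{R_0^{2,1,n}[r]}.$$ *)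

theory Defs
  imports
    Complex_Main
    "HOL-Library.Function_Algebras"
    "HOL-Library.Set_Algebras"
    "HOL-Library.Poly_Mapping"
begin

section \<open>Tensor products of copies of two vector spaces\<close>

text \<open>
  All iterated tensor products of two vector spaces \<open>C\<close> and \<open>M\<close> are realised inside one type.
  A word over \<^typ>\<open>'c + 'm\<close> stands for a pure tensor, its letters \<open>Inl\<close> and \<open>Inr\<close> telling which
  space each factor is taken from.  A tensor is a functional on the multilinear forms on words, the
  pure tensor of a word being evaluation at it; the tensor product of given factors is the span of
  the pure tensors of their shape.  Over a field this is the usual tensor product: see the
  universal property below.  Concatenation of words makes it strictly associative.
\<close>

type_synonym ('k, 'c, 'm) tensor = "(('c + 'm) list \<Rightarrow> 'k) \<Rightarrow> 'k"

definition pscale :: "('k \<Rightarrow> 'v \<Rightarrow> 'v) \<Rightarrow> 'k \<Rightarrow> ('x \<Rightarrow> 'v) \<Rightarrow> ('x \<Rightarrow> 'v)"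
  where "pscale s k f = (\<lambda>x. s k (f x))"

abbreviation tscale :: "'k::field \<Rightarrow> ('x \<Rightarrow> 'k) \<Rightarrow> ('x \<Rightarrow> 'k)"
  where "tscale \<equiv> pscale (*)"

lemma pscale_apply [simp]: "pscale s k f x = s k (f x)"
  by (simp add: pscale_def)

lemma vector_space_field: "vector_space ((*) :: 'k::field \<Rightarrow> 'k \<Rightarrow> 'k)"
  by standard (auto simp: algebra_simps)

lemma vector_space_pscale: "vector_space s \<Longrightarrow> vector_space (pscale s)"
  by (auto simp: vector_space_def fun_eq_iff)

lemmas pointwise = plus_fun_apply zero_fun_apply pscale_apply

locale two_spaces = C: vector_space sC + M: vector_space sM
  for sC :: "'k::field \<Rightarrow> 'c::ab_group_add \<Rightarrow> 'c"
    and sM :: "'k \<Rightarrow> 'm::ab_group_add \<Rightarrow> 'm"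
begin

definition multilin :: "('k \<Rightarrow> 'w::ab_group_add \<Rightarrow> 'w) \<Rightarrow> (('c + 'm) list \<Rightarrow> 'w) \<Rightarrow> bool"
  where "multilin sW \<phi> \<longleftrightarrow>
    (\<forall>u v. Vector_Spaces.linear sC sW (\<lambda>x. \<phi> (u @ Inl x # v)) \<and>
           Vector_Spaces.linear sM sW (\<lambda>y. \<phi> (u @ Inr y # v)))"

definition tprod :: "('c + 'm) list \<Rightarrow> ('k, 'c, 'm) tensor"
  where "tprod w = (\<lambda>\<phi>. if multilin (*) \<phi> then \<phi> w else 0)"

definition tensor_space :: "('c + 'm) set list \<Rightarrow> ('k, 'c, 'm) tensor set"
  where "tensor_space As = module.span tscale (tprod ` listset As)"

abbreviation CC :: "('c + 'm) set" where "CC \<equiv> range Inl"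
abbreviation MM :: "('c + 'm) set" where "MM \<equiv> range Inr"

text \<open>The bilinear extension of concatenation, \<open>tprod u \<odot> tprod v = tprod (u @ v)\<close>.\<close>

definition tconc :: "('k, 'c, 'm) tensor \<Rightarrow> ('k, 'c, 'm) tensor \<Rightarrow> ('k, 'c, 'm) tensor"  (infixr "\<odot>" 75)
  where "s \<odot> t = (\<lambda>\<psi>. if multilin (*) \<psi> then s (\<lambda>u. t (\<lambda>v. \<psi> (u @ v))) else 0)"

text \<open>
  \<open>tmap [g\<^sub>1, \<dots>, g\<^sub>k]\<close> is \<open>g\<^sub>1 \<otimes> \<dots> \<otimes> g\<^sub>k\<close>: it is linear, sends the pure tensor of \<open>[x\<^sub>1, \<dots>, x\<^sub>k]\<close>
  to \<open>g\<^sub>1 x\<^sub>1 \<odot> \<dots> \<odot> g\<^sub>k x\<^sub>k\<close> (lemma \<open>tmap_tprod\<close>) and pure tensors of other lengths to \<open>0\<close>.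
  The maps \<open>g\<^sub>i\<close> are given on letters; a map defined on \<open>C\<close> or on \<open>M\<close> only is extended by zero
  to the other kind of letter, on which it is never used.
\<close>

fun tword :: "('c + 'm \<Rightarrow> ('k, 'c, 'm) tensor) list \<Rightarrow> ('c + 'm) list \<Rightarrow> ('k, 'c, 'm) tensor"
  where
    "tword [] [] = tprod []"
  | "tword (g # gs) (x # w) = g x \<odot> tword gs w"
  | "tword _ _ = 0"

definition tmap :: "('c + 'm \<Rightarrow> ('k, 'c, 'm) tensor) list \<Rightarrow> ('k, 'c, 'm) tensor \<Rightarrow> ('k, 'c, 'm) tensor"
  where "tmap gs t = (\<lambda>\<psi>. if multilin (*) \<psi> then t (\<lambda>w. tword gs w \<psi>) else 0)"

definition idt :: "'c + 'm \<Rightarrow> ('k, 'c, 'm) tensor"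
  where "idt x = tprod [x]"

definition onC :: "('c \<Rightarrow> ('k, 'c, 'm) tensor) \<Rightarrow> 'c + 'm \<Rightarrow> ('k, 'c, 'm) tensor"
  where "onC f = case_sum f (\<lambda>_. 0)"

definition onM :: "('m \<Rightarrow> ('k, 'c, 'm) tensor) \<Rightarrow> 'c + 'm \<Rightarrow> ('k, 'c, 'm) tensor"
  where "onM f = case_sum (\<lambda>_. 0) f"

definition homC :: "('c + 'm) set list \<Rightarrow> ('c \<Rightarrow> ('k, 'c, 'm) tensor) set"
  where "homC As = {f. Vector_Spaces.linear sC tscale f \<and> range f \<subseteq> tensor_space As}"

definition homM :: "('c + 'm) set list \<Rightarrow> ('m \<Rightarrow> ('k, 'c, 'm) tensor) set"
  where "homM As = {f. Vector_Spaces.linear sM tscale f \<and> range f \<subseteq> tensor_space As}"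

lemma on_simps [simp]: "onC f (Inl c) = f c" "onC f (Inr m) = 0" "onM g (Inr m) = g m" "onM g (Inl c) = 0"
  by (simp_all add: onC_def onM_def)

subsection \<open>The universal property\<close>

lemma vector_space_tscale: "vector_space (tscale :: 'k \<Rightarrow> ('x \<Rightarrow> 'k) \<Rightarrow> ('x \<Rightarrow> 'k))"
  by (rule vector_space_pscale[OF vector_space_field])

lemma tprod_apply: "multilin (*) \<phi> \<Longrightarrow> tprod w \<phi> = \<phi> w"
  by (simp add: tprod_def)

lemma linear_iff':
  "Vector_Spaces.linear s1 s2 f \<longleftrightarrow> vector_space s1 \<and> vector_space s2 \<and>
     (\<forall>x y. f (x + y) = f x + f y) \<and> (\<forall>k x. f (s1 k x) = s2 k (f x))"
  unfolding Vector_Spaces.linear_def module_hom_def module_hom_axioms_def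
  by (auto simp: module_iff_vector_space)

lemma multilin_tprod: "multilin tscale tprod"
proof -
  have "tprod (u @ Inl (x + y) # v) = tprod (u @ Inl x # v) + tprod (u @ Inl y # v)"
    "tprod (u @ Inl (sC k x) # v) = tscale k (tprod (u @ Inl x # v))"
    "tprod (u @ Inr (x' + y') # v) = tprod (u @ Inr x' # v) + tprod (u @ Inr y' # v)"
    "tprod (u @ Inr (sM k x') # v) = tscale k (tprod (u @ Inr x' # v))" for u v x y x' y' k
    by (auto simp: tprod_def fun_eq_iff multilin_def linear_iff')
  then show ?thesis
    unfolding multilin_def linear_iff'
    using C.vector_space_axioms M.vector_space_axioms vector_space_tscale by blast
qed

theorem tensor_universal:
  fixes sW :: "'k \<Rightarrow> 'w::ab_group_add \<Rightarrow> 'w"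
  assumes W: "vector_space sW" and \<phi>: "multilin sW \<phi>"
  shows "\<exists>L. Vector_Spaces.linear tscale sW L \<and> (\<forall>w. L (tprod w) = \<phi> w)"
proof -
  interpret T: vector_space "tscale :: 'k \<Rightarrow> ('k, 'c, 'm) tensor \<Rightarrow> ('k, 'c, 'm) tensor"
    by (rule vector_space_tscale)
  interpret W: vector_space sW by fact
  interpret K: vector_space "(*) :: 'k \<Rightarrow> 'k \<Rightarrow> 'k" by (rule vector_space_field)
  interpret TW: vector_space_pair "tscale :: 'k \<Rightarrow> ('k, 'c, 'm) tensor \<Rightarrow> ('k, 'c, 'm) tensor" sW ..
  interpret WK: vector_space_pair sW "(*) :: 'k \<Rightarrow> 'k \<Rightarrow> 'k" ..
  obtain B where B: "B \<subseteq> range tprod" "T.independent B" "range tprod \<subseteq> T.span B"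
    using T.maximal_independent_subset[of "range tprod"] by blast
  define L where "L = TW.construct B (\<lambda>b. \<phi> (SOME w. tprod w = b))"
  have L: "Vector_Spaces.linear tscale sW L"
    unfolding L_def by (rule TW.linear_construct[OF B(2)])
  have key: "l (L t) = t (\<lambda>w. l (\<phi> w))"
    if l: "Vector_Spaces.linear sW (*) l" and t: "t \<in> T.span B" for l t
  proof -
    have m: "multilin (*) (\<lambda>w. l (\<phi> w))"
      using \<phi> l by (auto simp: multilin_def linear_iff')
    show ?thesis using t
    proof (induction rule: T.span_induct_alt)
      case base
      then show ?case using L l
        by (metis Vector_Spaces.linear_def module_hom.zero zero_fun_def)
    next
      case (step c b t)
      have "tprod (SOME w. tprod w = b) = b"
        using step B(1) by (metis (mono_tags, lifting) image_iff someI_ex subset_iff)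
      then have "L b = \<phi> (SOME w. tprod w = b)" "b (\<lambda>w. l (\<phi> w)) = l (\<phi> (SOME w. tprod w = b))"
        using step TW.construct_basis[OF B(2)] tprod_apply[OF m, of "SOME w. tprod w = b"]
        by (auto simp: L_def)
      moreover have "L (tscale c b + t) = sW c (L b) + L t"
        using L unfolding linear_iff' by metis
      moreover have "l (sW c (L b) + L t) = c * l (L b) + l (L t)"
        using l unfolding linear_iff' by metis
      moreover have "(tscale c b + t) (\<lambda>w. l (\<phi> w)) = c * b (\<lambda>w. l (\<phi> w)) + t (\<lambda>w. l (\<phi> w))"
        by simp
      ultimately show ?case using step by (simp only:)
    qed
  qed
  have "L (tprod w) = \<phi> w" for w
  proof (rule ccontr)
    assume ne: "L (tprod w) \<noteq> \<phi> w"
    define d where "d = L (tprod w) - \<phi> w"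
    define l where "l = WK.construct {d} (\<lambda>_. 1 :: 'k)"
    have i: "W.independent {d}" using ne by (simp add: d_def)
    have l: "Vector_Spaces.linear sW (*) l" "l d = 1"
      using WK.linear_construct[OF i] WK.construct_basis[OF i, of d] by (auto simp: l_def)
    have "multilin (*) (\<lambda>w. l (\<phi> w))"
      using \<phi> l(1) by (auto simp: multilin_def linear_iff')
    then have "l (L (tprod w)) = l (\<phi> w)"
      using key[OF l(1), of "tprod w"] B(3) by (auto simp: tprod_apply)
    moreover have "l d = l (L (tprod w)) - l (\<phi> w)"
      unfolding d_def using l(1) by (metis Vector_Spaces.linear_def module_hom.diff)
    ultimately show False using l(2) by simp
  qed
  with L show ?thesis by blast
qed

subsection \<open>Concatenation and tensor products of maps\<close>

abbreviation Tens :: "('k, 'c, 'm) tensor set"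
  where "Tens \<equiv> module.span tscale (range tprod)"

lemma Tens_induct [consumes 1, case_names zero step]:
  assumes "t \<in> module.span tscale (tprod ` S)"
    and "P 0" and "\<And>k w t. w \<in> S \<Longrightarrow> t \<in> module.span tscale (tprod ` S) \<Longrightarrow> P t \<Longrightarrow> P (tscale k (tprod w) + t)"
  shows "P t"
proof -
  interpret T: vector_space "tscale :: 'k \<Rightarrow> ('k, 'c, 'm) tensor \<Rightarrow> ('k, 'c, 'm) tensor"
    by (rule vector_space_tscale)
  have "t \<in> T.span (tprod ` S) \<and> P t" using assms(1)
  proof (induction rule: T.span_induct_alt)
    case base
    then show ?case using assms(2) T.span_zero by blast
  next
    case (step c x y)
    then show ?case using assms(3)
      by (metis (no_types, lifting) T.span_add T.span_base T.span_scale imageE)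
  qed
  then show ?thesis by blast
qed

lemma Tens_subspace: "module.subspace tscale Tens"
  using vector_space_tscale by (metis module_iff_vector_space module.subspace_span)

lemma Tens_closed [simp, intro]:
  "0 \<in> Tens" "tprod w \<in> Tens" "s \<in> Tens \<Longrightarrow> t \<in> Tens \<Longrightarrow> s + t \<in> Tens" "t \<in> Tens \<Longrightarrow> tscale k t \<in> Tens"
  using Tens_subspace module_iff_vector_space[THEN iffD2, OF vector_space_tscale]
  unfolding module.subspace_def[OF module_iff_vector_space[THEN iffD2, OF vector_space_tscale]]
  by (auto intro: module.span_base)

lemma multilin_field_simps:
  assumes "multilin (*) \<phi>" "multilin (*) \<psi>"
  shows "multilin (*) (\<lambda>w. 0)" "multilin (*) (\<lambda>w. \<phi> w + \<psi> w)" "multilin (*) (\<lambda>w. k * \<phi> w)"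
  using assms by (auto simp: multilin_def linear_iff' algebra_simps)

lemma multilin_append:
  assumes "multilin (*) \<psi>"
  shows "multilin (*) (\<lambda>v. \<psi> (u @ v))" "multilin (*) (\<lambda>u. \<psi> (u @ v))"
proof -
  have "\<psi> (u @ (u' @ x # v')) = \<psi> ((u @ u') @ x # v')" for u' x v' by simp
  then show "multilin (*) (\<lambda>v. \<psi> (u @ v))"
    using assms unfolding multilin_def by (simp only: simp_thms)
  have "\<psi> ((u' @ x # v') @ v) = \<psi> (u' @ x # (v' @ v))" for u' x v' by simp
  then show "multilin (*) (\<lambda>u. \<psi> (u @ v))"
    using assms unfolding multilin_def by (simp only: simp_thms)
qed

lemma Tens_additive:
  assumes "t \<in> Tens" "multilin (*) \<phi>" "multilin (*) \<psi>"
  shows "t (\<lambda>w. \<phi> w + \<psi> w) = t \<phi> + t \<psi>" "t (\<lambda>w. k * \<phi> w) = k * t \<phi>" "t (\<lambda>w. 0) = 0"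
  using assms(1)
  by (induction rule: Tens_induct)
     (auto simp: tprod_apply[OF assms(2)] tprod_apply[OF assms(3)]
        tprod_apply[OF multilin_field_simps(1)[OF assms(2,3)]]
        tprod_apply[OF multilin_field_simps(2)[OF assms(2,3)]]
        tprod_apply[OF multilin_field_simps(3)[OF assms(2,3)]] algebra_simps)

lemma multilin_tens:
  assumes "t \<in> Tens" "multilin (*) \<psi>"
  shows "multilin (*) (\<lambda>u. t (\<lambda>v. \<psi> (u @ v)))"
  using assms(1)
proof (induction rule: Tens_induct)
  case zero
  then show ?case using multilin_field_simps(1)[OF assms(2) assms(2)] by simp
next
  case (step k w t)
  have "multilin (*) (\<lambda>u. tprod w (\<lambda>v. \<psi> (u @ v)))"
    using multilin_append(2)[OF assms(2)] by (simp add: tprod_apply[OF multilin_append(1)[OF assms(2)]])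
  note a = multilin_field_simps(3)[OF this this, of k]
  show ?case using multilin_field_simps(2)[OF a step(3)] by simp
qed

lemma tconc_tprod [simp]: "tprod u \<odot> tprod v = tprod (u @ v)"
proof
  fix \<psi> :: "('c + 'm) list \<Rightarrow> 'k"
  show "(tprod u \<odot> tprod v) \<psi> = tprod (u @ v) \<psi>"
  proof (cases "multilin (*) \<psi>")
    case True
    have "multilin (*) (\<lambda>u. \<psi> (u @ v))" by (rule multilin_append(2)[OF True])
    then show ?thesis using True
      by (simp add: tconc_def tprod_apply[OF multilin_append(1)[OF True]] tprod_apply)
  qed (simp add: tconc_def tprod_def)
qed

lemma tconc_left [simp]:
  "0 \<odot> t = 0" "(s + s') \<odot> t = s \<odot> t + s' \<odot> t" "tscale k s \<odot> t = tscale k (s \<odot> t)"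
  by (auto simp: tconc_def fun_eq_iff)

lemma tconc_right:
  assumes "s \<in> Tens" 
  shows "s \<odot> 0 = 0" "t \<in> Tens \<Longrightarrow> t' \<in> Tens \<Longrightarrow> s \<odot> (t + t') = s \<odot> t + s \<odot> t'"
    "t \<in> Tens \<Longrightarrow> s \<odot> tscale k t = tscale k (s \<odot> t)"
proof -
  show "s \<odot> 0 = 0"
  proof
    fix \<psi> :: "('c + 'm) list \<Rightarrow> 'k"
    show "(s \<odot> 0) \<psi> = 0 \<psi>"
    proof (cases "multilin (*) \<psi>")
      case True
      then show ?thesis using Tens_additive(3)[OF assms True True] by (simp add: tconc_def)
    qed (simp add: tconc_def)
  qed
next
  assume t: "t \<in> Tens" "t' \<in> Tens"
  show "s \<odot> (t + t') = s \<odot> t + s \<odot> t'"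
  proof
    fix \<psi> :: "('c + 'm) list \<Rightarrow> 'k"
    show "(s \<odot> (t + t')) \<psi> = (s \<odot> t + s \<odot> t') \<psi>"
    proof (cases "multilin (*) \<psi>")
      case True
      from Tens_additive(1)[OF assms multilin_tens[OF t(1) True] multilin_tens[OF t(2) True]] True
      show ?thesis by (simp add: tconc_def)
    qed (simp add: tconc_def)
  qed
next
  assume t: "t \<in> Tens"
  show "s \<odot> tscale k t = tscale k (s \<odot> t)"
  proof
    fix \<psi> :: "('c + 'm) list \<Rightarrow> 'k"
    show "(s \<odot> tscale k t) \<psi> = (tscale k (s \<odot> t)) \<psi>"
    proof (cases "multilin (*) \<psi>")
      case True
      from Tens_additive(2)[OF assms multilin_tens[OF t(1) True] multilin_tens[OF t(1) True]] True
      show ?thesis by (simp add: tconc_def)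
    qed (simp add: tconc_def)
  qed
qed

context
  notes pointwise [simp del]
begin

lemma tconc_Tens [simp, intro]:
  assumes "s \<in> Tens" "t \<in> Tens" shows "s \<odot> t \<in> Tens"
  using assms(1)
proof (induction rule: Tens_induct)
  case (step k w s)
  have "tprod w \<odot> t \<in> Tens" using assms(2)
    by (induction rule: Tens_induct) (auto simp: tconc_right)
  then show ?case using step by auto
qed auto

lemma tconc_assoc:
  assumes "r \<in> Tens" "s \<in> Tens" "t \<in> Tens"
  shows "(r \<odot> s) \<odot> t = r \<odot> (s \<odot> t)"
  using assms(1)
proof (induction rule: Tens_induct)
  case (step k w r)
  have "(tprod w \<odot> s) \<odot> t = tprod w \<odot> (s \<odot> t)" using assms(2)
  proof (induction rule: Tens_induct)
    case (step k v s)
    have "(tprod w \<odot> tprod v) \<odot> t = tprod w \<odot> (tprod v \<odot> t)" using assms(3)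
      by (induction rule: Tens_induct) (auto simp: tconc_right)
    then show ?case using step assms(3) by (simp add: tconc_right tconc_Tens)
  qed (auto simp: tconc_right)
  then show ?case using step by simp
qed auto

definition letter_hom :: "('c + 'm \<Rightarrow> ('k, 'c, 'm) tensor) \<Rightarrow> bool"
  where "letter_hom g \<longleftrightarrow> range g \<subseteq> Tens \<and>
    Vector_Spaces.linear sC tscale (g \<circ> Inl) \<and> Vector_Spaces.linear sM tscale (g \<circ> Inr)"

lemma tensor_space_Tens: "tensor_space As \<subseteq> Tens"
  unfolding tensor_space_def
  by (metis image_mono module.span_mono module_iff_vector_space subset_UNIV vector_space_tscale)

lemma Tens_outside: "t \<in> Tens \<Longrightarrow> \<not> multilin (*) \<psi> \<Longrightarrow> t \<psi> = 0"
  by (induction rule: Tens_induct) (auto simp: tprod_def pointwise)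

lemma tconc_Nil [simp]:
  assumes "t \<in> Tens" shows "tprod [] \<odot> t = t" "t \<odot> tprod [] = t"
  using assms by (induction rule: Tens_induct) (auto simp: tconc_right)

lemma tword_Tens [simp, intro]: "\<forall>g\<in>set gs. letter_hom g \<Longrightarrow> tword gs w \<in> Tens"
  by (induction gs w rule: tword.induct) (auto simp: letter_hom_def)

lemma multilin_tword:
  assumes "\<forall>g\<in>set gs. letter_hom g" shows "multilin tscale (tword gs)"
proof -
  have "tword gs (u @ Inl (x + y) # v) = tword gs (u @ Inl x # v) + tword gs (u @ Inl y # v) \<and>
    tword gs (u @ Inl (sC k x) # v) = tscale k (tword gs (u @ Inl x # v)) \<and>
    tword gs (u @ Inr (x' + y') # v) = tword gs (u @ Inr x' # v) + tword gs (u @ Inr y' # v) \<and>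
    tword gs (u @ Inr (sM k x') # v) = tscale k (tword gs (u @ Inr x' # v))" for u v x y x' y' k
    using assms
  proof (induction gs arbitrary: u)
    case Nil
    then show ?case by (cases u) (auto simp: fun_eq_iff pointwise)
  next
    case (Cons g gs)
    have g: "letter_hom g" "\<And>a. g a \<in> Tens" and gs: "\<forall>g\<in>set gs. letter_hom g"
      using Cons.prems by (auto simp: letter_hom_def)
    show ?case
    proof (cases u)
      case Nil
      then show ?thesis using g(1) by (simp add: letter_hom_def linear_iff')
    next
      case (Cons a u')
      then show ?thesis using Cons.IH[OF gs, of u'] g(2)[of a] tword_Tens[OF gs]
        by (simp add: tconc_right)
    qed
  qed
  then show ?thesis unfolding multilin_def linear_iff'
    using C.vector_space_axioms M.vector_space_axioms vector_space_tscale by blast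
qed

lemma tmap_linear: "tmap gs 0 = 0" "tmap gs (s + t) = tmap gs s + tmap gs t"
  "tmap gs (tscale k t) = tscale k (tmap gs t)"
  by (auto simp: tmap_def fun_eq_iff pointwise)

lemma tmap_tprod:
  assumes "\<forall>g\<in>set gs. letter_hom g" shows "tmap gs (tprod w) = tword gs w"
proof
  fix \<psi> :: "('c + 'm) list \<Rightarrow> 'k"
  have "multilin (*) (\<lambda>w. tword gs w \<psi>)"
    using multilin_tword[OF assms] vector_space_field by (auto simp: multilin_def linear_iff' pointwise)
  then show "tmap gs (tprod w) \<psi> = tword gs w \<psi>"
    using Tens_outside[OF tword_Tens[OF assms]] by (auto simp: tmap_def tprod_apply)
qed

lemma tmap_Tens:
  assumes "\<forall>g\<in>set gs. letter_hom g" "t \<in> Tens" shows "tmap gs t \<in> Tens"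
  using assms(2)
  by (induction rule: Tens_induct)
     (auto simp: tmap_linear tmap_tprod assms(1))

lemma tword_append:
  assumes "\<forall>g\<in>set gs. letter_hom g" "\<forall>g\<in>set hs. letter_hom g" "length u = length gs"
  shows "tword (gs @ hs) (u @ v) = tword gs u \<odot> tword hs v"
  using assms(3,1)
proof (induction u gs rule: list_induct2)
  case Nil
  then show ?case using assms(2) by simp
next
  case (Cons x u g gs)
  moreover have "g x \<in> Tens" using Cons by (auto simp: letter_hom_def)
  ultimately show ?case using assms(2) by (simp add: tconc_assoc)
qed

lemma length_listset: "w \<in> listset As \<Longrightarrow> length w = length As"
  by (induction As arbitrary: w) (auto simp: set_Cons_def)

lemma tmap_append:
  assumes gs: "\<forall>g\<in>set gs. letter_hom g" and hs: "\<forall>g\<in>set hs. letter_hom g"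
    and s: "s \<in> tensor_space As" "length As = length gs" and t: "t \<in> Tens"
  shows "tmap (gs @ hs) (s \<odot> t) = tmap gs s \<odot> tmap hs t"
  using s(1) unfolding tensor_space_def
proof (induction rule: Tens_induct)
  case zero
  then show ?case by (simp add: tmap_linear)
next
  case (step k u s)
  have gh: "\<forall>g\<in>set (gs @ hs). letter_hom g" using gs hs by auto
  have "tmap (gs @ hs) (tprod u \<odot> t) = tword gs u \<odot> tmap hs t" using t
  proof (induction rule: Tens_induct)
    case zero
    show ?case using gs by (simp add: tconc_right tmap_linear)
  next
    case (step l v t)
    then show ?case using gs hs tmap_tprod[OF gh] \<open>u \<in> _\<close> s(2)
      by (simp add: tconc_right tmap_linear tmap_tprod tword_append length_listset tmap_Tens
              )
  qed
  then show ?case using step by (simp add: tmap_linear tmap_tprod gs)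
qed

lemma tensor_eqI:
  assumes "t \<in> tensor_space As" "F 0 = 0" "G 0 = 0"
    "\<And>s t. F (s + t) = F s + F t" "\<And>k t. F (tscale k t) = tscale k (F t)"
    "\<And>s t. G (s + t) = G s + G t" "\<And>k t. G (tscale k t) = tscale k (G t)"
    "\<And>w. w \<in> listset As \<Longrightarrow> F (tprod w) = (G (tprod w) :: ('k, 'c, 'm) tensor)"
  shows "F t = G t"
  using assms(1) unfolding tensor_space_def
  by (induction rule: Tens_induct) (simp_all add: assms)

lemma tprod_in_tensor_space: "w \<in> listset As \<Longrightarrow> tprod w \<in> tensor_space As"
  unfolding tensor_space_def
  by (metis imageI module.span_base module_iff_vector_space vector_space_tscale)

lemma tmap_tensor_space:
  assumes "t \<in> tensor_space As" "\<forall>g\<in>set gs. letter_hom g"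
    "\<And>w. w \<in> listset As \<Longrightarrow> tword gs w \<in> tensor_space Bs"
  shows "tmap gs t \<in> tensor_space Bs"
proof -
  interpret T: vector_space "tscale :: 'k \<Rightarrow> ('k, 'c, 'm) tensor \<Rightarrow> ('k, 'c, 'm) tensor"
    by (rule vector_space_tscale)
  show ?thesis
    using assms(1) unfolding tensor_space_def
    by (induction rule: Tens_induct)
       (use assms(2,3) in \<open>auto simp: tmap_linear tmap_tprod T.span_zero tensor_space_def
          intro!: T.span_add T.span_scale\<close>)
qed

lemma letter_hom_intros:
  "letter_hom idt"
  "f \<in> homC As \<Longrightarrow> letter_hom (onC f)"
  "g \<in> homM As \<Longrightarrow> letter_hom (onM g)"
proof -
  show "letter_hom idt"
    using multilin_tprod unfolding multilin_def letter_hom_def idt_def comp_def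
    by (auto dest!: spec[of _ "[]"])
  have z: "Vector_Spaces.linear sC tscale (\<lambda>_. 0)" "Vector_Spaces.linear sM tscale (\<lambda>_. 0)"
    unfolding linear_iff'
    using C.vector_space_axioms M.vector_space_axioms vector_space_tscale by (auto simp: fun_eq_iff pointwise)
  show "f \<in> homC As \<Longrightarrow> letter_hom (onC f)" "g \<in> homM As \<Longrightarrow> letter_hom (onM g)"
    using tensor_space_Tens[THEN subsetD] z unfolding letter_hom_def onC_def onM_def homC_def homM_def comp_def
    by (auto split: sum.splits simp: image_subset_iff)
qed

end

end

section \<open>Dendriform coalgebras and their cohomology\<close>

definition R0 :: "nat \<Rightarrow> nat \<Rightarrow> nat \<Rightarrow> nat \<Rightarrow> nat"
  where "R0 m i n r = (if r \<le> i - 1 then r else if r \<le> i + n - 1 then i else r - n + 1)"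

text \<open>\<open>nat \<Rightarrow>\<^sub>0 'k\<close> contains \<open>\<K>[C\<^sub>n]\<close> as the span of the basis vectors \<open>[1], \<dots>, [n]\<close>.\<close>

abbreviation bas :: "nat \<Rightarrow> nat \<Rightarrow>\<^sub>0 'k::field"
  where "bas r \<equiv> Poly_Mapping.single r 1"

definition R1 :: "nat \<Rightarrow> nat \<Rightarrow> nat \<Rightarrow> nat \<Rightarrow> nat \<Rightarrow>\<^sub>0 'k::field"
  where "R1 m i n r = (if i \<le> r \<and> r \<le> i + n - 1 then bas (r - i + 1) else (\<Sum>j=1..n. bas j))"

text \<open>
  A linear map \<open>\<sigma>\<close> on \<open>\<K>[C\<^sub>n] \<otimes> X\<close> is given by the linear maps \<open>\<sigma> r = \<sigma>\<^bsub>[r]\<^esub>\<close> on \<open>X\<close>, \<open>1 \<le> r \<le> n\<close>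
  (with \<open>\<sigma> r = 0\<close> for all other \<open>r\<close>); \<open>at_vec \<sigma> x\<close> is \<open>\<sigma>\<^sub>x\<close> for \<open>x \<in> \<K>[C\<^sub>n]\<close>.
\<close>

definition at_vec :: "(nat \<Rightarrow> 'x \<Rightarrow> ('k::field, 'c, 'm) tensor) \<Rightarrow> (nat \<Rightarrow>\<^sub>0 'k) \<Rightarrow> 'x \<Rightarrow> ('k, 'c, 'm) tensor"
  where "at_vec \<sigma> x = (\<lambda>m. \<Sum>r\<in>Poly_Mapping.keys x. tscale (Poly_Mapping.lookup x r) (\<sigma> r m))"

locale dendriform_coalgebra = two_spaces sC sM
  for sC :: "'k::field \<Rightarrow> 'c::ab_group_add \<Rightarrow> 'c"
    and sM :: "'k \<Rightarrow> 'm::ab_group_add \<Rightarrow> 'm" +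
  fixes prec succ :: "'m \<Rightarrow> ('k, 'c, 'm) tensor"
  assumes prec_hom: "prec \<in> homM [MM, MM]"
    and succ_hom: "succ \<in> homM [MM, MM]"
    and dend1: "tmap [onM prec, idt] (prec m) = tmap [idt, onM (\<lambda>x. prec x + succ x)] (prec m)"
    and dend2: "tmap [onM succ, idt] (prec m) = tmap [idt, onM prec] (succ m)"
    and dend3: "tmap [onM (\<lambda>x. prec x + succ x), idt] (succ m) = tmap [idt, onM succ] (succ m)"
begin

definition comult :: "nat \<Rightarrow> 'm \<Rightarrow> ('k, 'c, 'm) tensor"
  where "comult r = (if r = 1 then prec else if r = 2 then succ else (\<lambda>_. 0))"

definition coDend_cochains :: "nat \<Rightarrow> (nat \<Rightarrow> 'm \<Rightarrow> ('k, 'c, 'm) tensor) set"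
  where "coDend_cochains n =
    {\<sigma>. (\<forall>r\<in>{1..n}. \<sigma> r \<in> homM (replicate n MM)) \<and> (\<forall>r. r \<notin> {1..n} \<longrightarrow> \<sigma> r = (\<lambda>_. 0))}"

definition delta_c :: "nat \<Rightarrow> (nat \<Rightarrow> 'm \<Rightarrow> ('k, 'c, 'm) tensor) \<Rightarrow> nat \<Rightarrow> 'm \<Rightarrow> ('k, 'c, 'm) tensor"
  where "delta_c n \<sigma> = (\<lambda>r m. if r \<in> {1..n+1} then
      tmap [idt, onM (at_vec \<sigma> (R1 2 2 n r))] (comult (R0 2 2 n r) m)
      + (\<Sum>i=1..n. tscale ((-1) ^ i)
          (tmap (replicate (i - 1) idt @ [onM (at_vec comult (R1 n i 2 r))] @ replicate (n - i) idt)
            (\<sigma> (R0 n i 2 r) m)))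
      + tscale ((-1) ^ (n + 1)) (tmap [onM (at_vec \<sigma> (R1 2 1 n r)), idt] (comult (R0 2 1 n r) m))
    else 0)"

end

section \<open>Relative Rota-Baxter operators and their cohomology\<close>

locale coalgebra_bicomodule = two_spaces sC sM
  for sC :: "'k::field \<Rightarrow> 'c::ab_group_add \<Rightarrow> 'c"
    and sM :: "'k \<Rightarrow> 'm::ab_group_add \<Rightarrow> 'm" +
  fixes Delta :: "'c \<Rightarrow> ('k, 'c, 'm) tensor"
    and Dl Dr :: "'m \<Rightarrow> ('k, 'c, 'm) tensor"
  assumes Delta_hom: "Delta \<in> homC [CC, CC]"
    and coassoc: "tmap [onC Delta, idt] (Delta c) = tmap [idt, onC Delta] (Delta c)"
    and Dl_hom: "Dl \<in> homM [CC, MM]"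
    and Dr_hom: "Dr \<in> homM [MM, CC]"
    and bicomodule_l: "tmap [onC Delta, idt] (Dl m) = tmap [idt, onM Dl] (Dl m)"
    and bicomodule_lr: "tmap [onM Dl, idt] (Dr m) = tmap [idt, onM Dr] (Dl m)"
    and bicomodule_r: "tmap [onM Dr, idt] (Dr m) = tmap [idt, onC Delta] (Dr m)"

text \<open>\<open>map_letter T\<close> is the operator \<open>T\<close> as a map from letters to tensors, for use in \<open>tmap\<close>.\<close>

definition (in two_spaces) map_letter :: "('c \<Rightarrow> 'm) \<Rightarrow> 'c + 'm \<Rightarrow> ('k, 'c, 'm) tensor"
  where "map_letter T = onC (\<lambda>c. idt (Inr (T c)))"

locale relative_rota_baxter = coalgebra_bicomodule sC sM Delta Dl Dr
  for sC :: "'k::field \<Rightarrow> 'c::ab_group_add \<Rightarrow> 'c"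
    and sM :: "'k \<Rightarrow> 'm::ab_group_add \<Rightarrow> 'm"
    and Delta Dl Dr +
  fixes T :: "'c \<Rightarrow> 'm"
  assumes T_linear: "Vector_Spaces.linear sC sM T"
    and rota_baxter: "tmap [map_letter T, map_letter T] (Delta c) =
      tmap [idt, map_letter T] (Dr (T c)) + tmap [map_letter T, idt] (Dl (T c))"
begin

definition prec :: "'m \<Rightarrow> ('k, 'c, 'm) tensor"
  where "prec m = tmap [idt, map_letter T] (Dr m)"

definition succ :: "'m \<Rightarrow> ('k, 'c, 'm) tensor"
  where "succ m = tmap [map_letter T, idt] (Dl m)"

text \<open>In degree \<open>0\<close> the complex is zero.\<close>

definition T_cochains :: "nat \<Rightarrow> ('c \<Rightarrow> ('k, 'c, 'm) tensor) set"
  where "T_cochains n = (if n = 0 then {0} else homC (replicate n MM))"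

definition delta :: "nat \<Rightarrow> ('c \<Rightarrow> ('k, 'c, 'm) tensor) \<Rightarrow> 'c \<Rightarrow> ('k, 'c, 'm) tensor"
  where "delta n f = (\<lambda>c.
      tmap [idt, onC f] (tmap [map_letter T, idt] (Delta c))
      - tmap [idt, onC f] (Dr (T c))
      + (\<Sum>i=1..n. tscale ((-1) ^ i)
          (tmap (replicate (i - 1) idt @ [onM (\<lambda>m. prec m + succ m)] @ replicate (n - i) idt) (f c)))
      + tscale ((-1) ^ (n + 1)) (tmap [onC f, idt] (tmap [idt, map_letter T] (Delta c)))
      - tscale ((-1) ^ (n + 1)) (tmap [onC f, idt] (Dl (T c))))"

definition d_T :: "nat \<Rightarrow> ('c \<Rightarrow> ('k, 'c, 'm) tensor) \<Rightarrow> 'c \<Rightarrow> ('k, 'c, 'm) tensor"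
  where "d_T n f = pscale tscale ((-1) ^ n) (delta n f)"

definition Theta :: "nat \<Rightarrow> ('c \<Rightarrow> ('k, 'c, 'm) tensor) \<Rightarrow> nat \<Rightarrow> 'm \<Rightarrow> ('k, 'c, 'm) tensor"
  where "Theta n f = (\<lambda>r m.
    if r = 1 then tscale ((-1) ^ (n + 1)) (tmap [idt, onC f] (Dr m))
    else if r = n + 1 then tmap [onC f, idt] (Dl m)
    else 0)"

lemma letter_homs:
  "letter_hom idt" "letter_hom (onC Delta)" "letter_hom (onM Dl)" "letter_hom (onM Dr)"
  "letter_hom (map_letter T)"
proof -
  show "letter_hom idt" "letter_hom (onC Delta)" "letter_hom (onM Dl)" "letter_hom (onM Dr)"
    using letter_hom_intros Delta_hom Dl_hom Dr_hom by auto
  have "(\<lambda>c. idt (Inr (T c))) \<in> homC [MM]"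
    using letter_hom_intros(1) T_linear C.vector_space_axioms
    by (auto simp: homC_def letter_hom_def linear_iff' idt_def set_Cons_def
          intro!: tprod_in_tensor_space)
  then show "letter_hom (map_letter T)"
    unfolding map_letter_def by (rule letter_hom_intros)
qed

lemma prec_succ_homM: "prec \<in> homM [MM, MM]" "succ \<in> homM [MM, MM]"
proof -
  have "prec m \<in> tensor_space [MM, MM]" for m
    unfolding prec_def
    by (rule tmap_tensor_space[of _ "[MM, CC]"])
       (use Dr_hom letter_homs in \<open>auto simp: homM_def set_Cons_def idt_def map_letter_def onC_def
          intro!: tprod_in_tensor_space\<close>)
  moreover have "succ m \<in> tensor_space [MM, MM]" for m
    unfolding succ_def
    by (rule tmap_tensor_space[of _ "[CC, MM]"])
       (use Dl_hom letter_homs in \<open>auto simp: homM_def set_Cons_def idt_def map_letter_def onC_def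
          intro!: tprod_in_tensor_space\<close>)
  ultimately show "prec \<in> homM [MM, MM]" "succ \<in> homM [MM, MM]"
    using Dl_hom Dr_hom
    by (auto simp: homM_def linear_iff' prec_def succ_def tmap_linear simp del: pointwise)
qed

lemma letter_homs_dend:
  "letter_hom (onM prec)" "letter_hom (onM succ)" "letter_hom (onM (\<lambda>m. prec m + succ m))"
proof -
  show ps: "letter_hom (onM prec)" "letter_hom (onM succ)"
    using prec_succ_homM letter_hom_intros by blast+
  have "onM (\<lambda>m. prec m + succ m) = (\<lambda>x. onM prec x + onM succ x)"
    by (auto simp: onM_def fun_eq_iff split: sum.splits)
  moreover have "tscale k (s + t) = tscale k s + tscale k t" for k and s t :: "('k, 'c, 'm) tensor"
    by (simp add: fun_eq_iff algebra_simps)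
  ultimately show "letter_hom (onM (\<lambda>m. prec m + succ m))"
    using ps unfolding letter_hom_def linear_iff'
    by (auto simp: image_subset_iff algebra_simps simp del: pointwise)
qed

theorem induced_dendriform_coalgebra: "dendriform_coalgebra sC sM prec succ"
proof -
  let ?T = "map_letter T"
  note h = letter_homs letter_homs_dend
  note lin = tmap_linear
  have spaces: "Delta c \<in> tensor_space [CC, CC]" "Dl m \<in> tensor_space [CC, MM]"
    "Dr m \<in> tensor_space [MM, CC]" for c m
    using Delta_hom Dl_hom Dr_hom by (auto simp: homC_def homM_def)
  have Tens: "Delta c \<in> Tens" "Dl m \<in> Tens" "Dr m \<in> Tens" "prec m \<in> Tens" "succ m \<in> Tens" for c m
    using spaces[THEN tensor_space_Tens[THEN subsetD]] prec_succ_homM tensor_space_Tens[of "[MM, MM]", THEN subsetD]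
    by (auto simp: homM_def image_subset_iff)
  have T_Inl: "?T (Inl c) = tprod [Inr (T c)]" for c
    by (simp add: map_letter_def onC_def idt_def)
  have rb: "prec (T c) + succ (T c) = tmap [?T, ?T] (Delta c)" for c
    using rota_baxter by (simp add: prec_def succ_def)
  have eq1: "tmap [onM prec, idt] (tmap [idt, ?T] t) = tmap [idt, ?T, ?T] (tmap [onM Dr, idt] t)"
    "tmap [idt, onM (\<lambda>x. prec x + succ x)] (tmap [idt, ?T] t) =
       tmap [idt, ?T, ?T] (tmap [idt, onC Delta] t)"
    "tmap [onM succ, idt] (tmap [idt, ?T] t) = tmap [?T, idt, ?T] (tmap [onM Dl, idt] t)"
    if "t \<in> tensor_space [MM, CC]" for t
  proof -
    show "tmap [onM prec, idt] (tmap [idt, ?T] t) = tmap [idt, ?T, ?T] (tmap [onM Dr, idt] t)"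
    proof (rule tensor_eqI[OF that])
      fix w assume "w \<in> listset [MM, CC]"
      then obtain m c where w: "w = [Inr m, Inl c]" by (auto simp: set_Cons_def)
      have "tmap ([idt, ?T] @ [?T]) (Dr m \<odot> tprod [Inl c]) = tmap [idt, ?T] (Dr m) \<odot> tmap [?T] (tprod [Inl c])"
        by (rule tmap_append[OF _ _ spaces(3)]) (auto simp: h)
      then show "tmap [onM prec, idt] (tmap [idt, ?T] (tprod w)) =
          tmap [idt, ?T, ?T] (tmap [onM Dr, idt] (tprod w))"
        by (simp add: w tmap_tprod h T_Inl idt_def prec_def)
    qed (auto simp: lin simp del: pointwise)
    show "tmap [onM succ, idt] (tmap [idt, ?T] t) = tmap [?T, idt, ?T] (tmap [onM Dl, idt] t)"
    proof (rule tensor_eqI[OF that])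
      fix w assume "w \<in> listset [MM, CC]"
      then obtain m c where w: "w = [Inr m, Inl c]" by (auto simp: set_Cons_def)
      have "tmap ([?T, idt] @ [?T]) (Dl m \<odot> tprod [Inl c]) = tmap [?T, idt] (Dl m) \<odot> tmap [?T] (tprod [Inl c])"
        by (rule tmap_append[OF _ _ spaces(2)]) (auto simp: h)
      then show "tmap [onM succ, idt] (tmap [idt, ?T] (tprod w)) =
          tmap [?T, idt, ?T] (tmap [onM Dl, idt] (tprod w))"
        by (simp add: w tmap_tprod h T_Inl idt_def succ_def)
    qed (auto simp: lin simp del: pointwise)
    show "tmap [idt, onM (\<lambda>x. prec x + succ x)] (tmap [idt, ?T] t) =
       tmap [idt, ?T, ?T] (tmap [idt, onC Delta] t)"
    proof (rule tensor_eqI[OF that])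
      fix w assume "w \<in> listset [MM, CC]"
      then obtain m c where w: "w = [Inr m, Inl c]" by (auto simp: set_Cons_def)
      have "tmap ([idt] @ [?T, ?T]) (tprod [Inr m] \<odot> Delta c) = tmap [idt] (tprod [Inr m]) \<odot> tmap [?T, ?T] (Delta c)"
        by (rule tmap_append[of _ _ _ "[MM]"])
           (auto simp: h Tens set_Cons_def intro!: tprod_in_tensor_space)
      then show "tmap [idt, onM (\<lambda>x. prec x + succ x)] (tmap [idt, ?T] (tprod w)) =
          tmap [idt, ?T, ?T] (tmap [idt, onC Delta] (tprod w))"
        by (simp add: w tmap_tprod h T_Inl idt_def rb Tens tmap_Tens del: pointwise)
    qed (auto simp: lin simp del: pointwise)
  qed
  have eq2: "tmap [idt, onM succ] (tmap [?T, idt] t) = tmap [?T, ?T, idt] (tmap [idt, onM Dl] t)"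
    "tmap [onM (\<lambda>x. prec x + succ x), idt] (tmap [?T, idt] t) =
       tmap [?T, ?T, idt] (tmap [onC Delta, idt] t)"
    "tmap [idt, onM prec] (tmap [?T, idt] t) = tmap [?T, idt, ?T] (tmap [idt, onM Dr] t)"
    if "t \<in> tensor_space [CC, MM]" for t
  proof -
    show "tmap [idt, onM succ] (tmap [?T, idt] t) = tmap [?T, ?T, idt] (tmap [idt, onM Dl] t)"
    proof (rule tensor_eqI[OF that])
      fix w assume "w \<in> listset [CC, MM]"
      then obtain m c where w: "w = [Inl c, Inr m]" by (auto simp: set_Cons_def)
      have "tmap ([?T] @ [?T, idt]) (tprod [Inl c] \<odot> Dl m) = tmap [?T] (tprod [Inl c]) \<odot> tmap [?T, idt] (Dl m)"
        by (rule tmap_append[of _ _ _ "[CC]"])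
           (auto simp: h Tens set_Cons_def intro!: tprod_in_tensor_space)
      then show "tmap [idt, onM succ] (tmap [?T, idt] (tprod w)) =
          tmap [?T, ?T, idt] (tmap [idt, onM Dl] (tprod w))"
        by (simp add: w tmap_tprod h T_Inl idt_def succ_def Tens tmap_Tens)
    qed (auto simp: lin simp del: pointwise)
    show "tmap [idt, onM prec] (tmap [?T, idt] t) = tmap [?T, idt, ?T] (tmap [idt, onM Dr] t)"
    proof (rule tensor_eqI[OF that])
      fix w assume "w \<in> listset [CC, MM]"
      then obtain m c where w: "w = [Inl c, Inr m]" by (auto simp: set_Cons_def)
      have "tmap ([?T] @ [idt, ?T]) (tprod [Inl c] \<odot> Dr m) = tmap [?T] (tprod [Inl c]) \<odot> tmap [idt, ?T] (Dr m)"
        by (rule tmap_append[of _ _ _ "[CC]"])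
           (auto simp: h Tens set_Cons_def intro!: tprod_in_tensor_space)
      then show "tmap [idt, onM prec] (tmap [?T, idt] (tprod w)) =
          tmap [?T, idt, ?T] (tmap [idt, onM Dr] (tprod w))"
        by (simp add: w tmap_tprod h T_Inl idt_def prec_def Tens tmap_Tens)
    qed (auto simp: lin simp del: pointwise)
    show "tmap [onM (\<lambda>x. prec x + succ x), idt] (tmap [?T, idt] t) =
       tmap [?T, ?T, idt] (tmap [onC Delta, idt] t)"
    proof (rule tensor_eqI[OF that])
      fix w assume "w \<in> listset [CC, MM]"
      then obtain m c where w: "w = [Inl c, Inr m]" by (auto simp: set_Cons_def)
      have "tmap ([?T, ?T] @ [idt]) (Delta c \<odot> tprod [Inr m]) = tmap [?T, ?T] (Delta c) \<odot> tmap [idt] (tprod [Inr m])"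
        by (rule tmap_append[OF _ _ spaces(1)]) (auto simp: h)
      then show "tmap [onM (\<lambda>x. prec x + succ x), idt] (tmap [?T, idt] (tprod w)) =
          tmap [?T, ?T, idt] (tmap [onC Delta, idt] (tprod w))"
        by (simp add: w tmap_tprod h T_Inl idt_def rb del: pointwise)
    qed (auto simp: lin simp del: pointwise)
  qed
  show ?thesis
  proof
    show "tmap [onM prec, idt] (prec m) = tmap [idt, onM (\<lambda>x. prec x + succ x)] (prec m)" for m
      using eq1(1,2)[OF spaces(3), of m] bicomodule_r[of m] by (simp add: prec_def[of m])
    show "tmap [onM succ, idt] (prec m) = tmap [idt, onM prec] (succ m)" for m
      using eq1(3)[OF spaces(3), of m] eq2(3)[OF spaces(2), of m] bicomodule_lr[of m]
      by (simp add: prec_def[of m] succ_def[of m])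
    show "tmap [onM (\<lambda>x. prec x + succ x), idt] (succ m) = tmap [idt, onM succ] (succ m)" for m
      using eq2(1,2)[OF spaces(2), of m] bicomodule_l[of m] by (simp add: succ_def[of m])
  qed (rule prec_succ_homM)+
qed

sublocale dendriform_coalgebra sC sM prec succ
  by (rule induced_dendriform_coalgebra)

end

section \<open>Cohomology\<close>

text \<open>
  A cochain complex is a family \<open>A n\<close> of subspaces of a vector space with scalar multiplication \<open>s\<close>,
  and differentials \<open>d n\<close> from \<open>A n\<close> to \<open>A (n + 1)\<close>.  Cohomology is taken as the set of cosets of
  coboundaries represented by cocycles.
\<close>

definition cocycles :: "(nat \<Rightarrow> 'v::ab_group_add set) \<Rightarrow> (nat \<Rightarrow> 'v \<Rightarrow> 'v) \<Rightarrow> nat \<Rightarrow> 'v set"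
  where "cocycles A d n = {z \<in> A n. d n z = 0}"

definition coboundaries :: "(nat \<Rightarrow> 'v::ab_group_add set) \<Rightarrow> (nat \<Rightarrow> 'v \<Rightarrow> 'v) \<Rightarrow> nat \<Rightarrow> 'v set"
  where "coboundaries A d n = (if n = 0 then {0} else d (n - 1) ` A (n - 1))"

definition cohomology_class :: "(nat \<Rightarrow> 'v::ab_group_add set) \<Rightarrow> (nat \<Rightarrow> 'v \<Rightarrow> 'v) \<Rightarrow> nat \<Rightarrow> 'v \<Rightarrow> 'v set"
  where "cohomology_class A d n z = z +o coboundaries A d n"

definition cohomology :: "(nat \<Rightarrow> 'v::ab_group_add set) \<Rightarrow> (nat \<Rightarrow> 'v \<Rightarrow> 'v) \<Rightarrow> nat \<Rightarrow> 'v set set"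
  where "cohomology A d n = cohomology_class A d n ` cocycles A d n"

text \<open>
  Cosets are added as sets.  In the scalar multiple the coboundaries have to be added again, as
  \<open>s 0 ` X\<close> is not a coset.
\<close>

definition cohomology_scale ::
    "('k \<Rightarrow> 'v \<Rightarrow> 'v) \<Rightarrow> (nat \<Rightarrow> 'v::ab_group_add set) \<Rightarrow> (nat \<Rightarrow> 'v \<Rightarrow> 'v) \<Rightarrow> nat \<Rightarrow> 'k \<Rightarrow> 'v set \<Rightarrow> 'v set"
  where "cohomology_scale s A d n k X = s k ` X + coboundaries A d n"

text \<open>\<open>Phi\<close> is a morphism of graded vector spaces of degree \<open>p\<close> between cohomologies.\<close>

definition cohomology_morphism ::
    "nat \<Rightarrow> ('k \<Rightarrow> 'v \<Rightarrow> 'v) \<Rightarrow> (nat \<Rightarrow> 'v::ab_group_add set) \<Rightarrow> (nat \<Rightarrow> 'v \<Rightarrow> 'v)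
      \<Rightarrow> ('k \<Rightarrow> 'w \<Rightarrow> 'w) \<Rightarrow> (nat \<Rightarrow> 'w::ab_group_add set) \<Rightarrow> (nat \<Rightarrow> 'w \<Rightarrow> 'w)
      \<Rightarrow> (nat \<Rightarrow> 'v set \<Rightarrow> 'w set) \<Rightarrow> bool"
  where "cohomology_morphism p s A d s' A' d' Phi \<longleftrightarrow>
    (\<forall>n. Phi n ` cohomology A d n \<subseteq> cohomology A' d' (n + p) \<and>
      (\<forall>X\<in>cohomology A d n. \<forall>Y\<in>cohomology A d n. Phi n (X + Y) = Phi n X + Phi n Y) \<and>
      (\<forall>k. \<forall>X\<in>cohomology A d n.
        Phi n (cohomology_scale s A d n k X) = cohomology_scale s' A' d' (n + p) k (Phi n X)))"

text \<open>A family of maps of cochains induces \<open>Phi\<close> if it descends to the quotients as \<open>Phi\<close>.\<close>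

definition induces_on_cohomology ::
    "nat \<Rightarrow> (nat \<Rightarrow> 'v::ab_group_add set) \<Rightarrow> (nat \<Rightarrow> 'v \<Rightarrow> 'v)
      \<Rightarrow> (nat \<Rightarrow> 'w::ab_group_add set) \<Rightarrow> (nat \<Rightarrow> 'w \<Rightarrow> 'w)
      \<Rightarrow> (nat \<Rightarrow> 'v \<Rightarrow> 'w) \<Rightarrow> (nat \<Rightarrow> 'v set \<Rightarrow> 'w set) \<Rightarrow> bool"
  where "induces_on_cohomology p A d A' d' F Phi \<longleftrightarrow>
    (\<forall>n. F n ` A n \<subseteq> A' (n + p) \<and>
      F n ` cocycles A d n \<subseteq> cocycles A' d' (n + p) \<and>
      F n ` coboundaries A d n \<subseteq> coboundaries A' d' (n + p) \<and>
      (\<forall>z\<in>cocycles A d n.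
        Phi n (cohomology_class A d n z) = cohomology_class A' d' (n + p) (F n z)))"

end

theory Submission
  imports Defs
begin

text \<open>
  The point is the identity \<open>\<delta>\<^sub>c (\<Theta>\<^sub>n f) = \<Theta>\<^sub>n\<^sub>+\<^sub>1 (\<delta> f)\<close> for \<open>f : C \<rightarrow> M\<^sup>\<otimes>\<^sup>n\<close>, \<open>n \<ge> 1\<close> (theorem
  \<open>delta_c_Theta\<close>).  As \<open>d\<^sub>T f = (-1)\<^sup>n \<delta> f\<close>, the maps \<open>\<Theta>\<^sub>n\<close> commute with the differentials up to sign, and
  linear maps that do so up to nonzero scalars already map cocycles to cocycles and coboundaries to
  coboundaries (\<open>cochain_map_induces_morphism\<close>).

  The identity is checked component by component.  Write \<open>f\<^sub>r = (id \<otimes> f) \<triangle>\<^sup>r\<close> and \<open>f\<^sub>l = (f \<otimes> id) \<triangle>\<^sup>l\<close>, so that up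
  to sign these are the first and the last component of \<open>\<Theta>\<^sub>n f\<close>.

  In the component \<open>[1]\<close> the cochain \<open>\<delta>\<^sub>c (\<Theta>\<^sub>n f)\<close> expands, up to signs, into one term \<open>(id \<otimes> g) \<triangle>\<^sup>r\<close> for each
  summand \<open>g\<close> of \<open>\<delta> f\<close>.
  The map \<open>T\<close> inside \<open>\<triangle>\<^sub>\<prec> = (id \<otimes> T) \<triangle>\<^sup>r\<close> can be composed with what is applied to the second factor:
  \<open>(id \<otimes> (f\<^sub>r + f\<^sub>l)) \<triangle>\<^sub>\<prec>\<close> gives the two summands of \<open>\<delta> f\<close> that start with \<open>T\<close>.  The law
  \<open>(\<triangle>\<^sup>r \<otimes> id) \<triangle>\<^sup>r = (id \<otimes> \<triangle>) \<triangle>\<^sup>r\<close> turns \<open>(\<triangle>\<^sub>\<prec> \<otimes> id) f\<^sub>r\<close> into \<open>(id \<otimes> (T \<otimes> f) \<triangle>) \<triangle>\<^sup>r\<close> and \<open>(f\<^sub>r \<otimes> id) \<triangle>\<^sub>\<prec>\<close> into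
  \<open>(id \<otimes> (f \<otimes> T) \<triangle>) \<triangle>\<^sup>r\<close>.  In the other summands \<open>\<triangle>\<^sub>\<prec> + \<triangle>\<^sub>\<succ>\<close> acts on a factor produced by \<open>f\<close>.  The component
  \<open>[n + 2]\<close> is the mirror image, with \<open>\<triangle>\<^sup>l\<close> and \<open>\<triangle>\<^sub>\<succ>\<close>.

  The components in between vanish.  Only \<open>[2]\<close> and \<open>[n + 1]\<close> have nonzero summands, and these cancel
  in pairs: \<open>(id \<otimes> f\<^sub>r) \<triangle>\<^sub>\<succ>\<close> against \<open>(\<triangle>\<^sub>\<succ> \<otimes> id) f\<^sub>r\<close> in \<open>[2]\<close>, and \<open>(f\<^sub>l \<otimes> id) \<triangle>\<^sub>\<prec>\<close> against \<open>(id \<otimes> \<triangle>\<^sub>\<prec>) f\<^sub>l\<close> in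
  \<open>[n + 1]\<close>, both by \<open>(\<triangle>\<^sup>l \<otimes> id) \<triangle>\<^sup>r = (id \<otimes> \<triangle>\<^sup>r) \<triangle>\<^sup>l\<close>.
\<close>

section \<open>Maps induced on cohomology\<close>

locale linear_differentials = vector_space s
  for s :: "'k::field \<Rightarrow> 'v::ab_group_add \<Rightarrow> 'v" +
  fixes A :: "nat \<Rightarrow> 'v set" and d :: "nat \<Rightarrow> 'v \<Rightarrow> 'v"
  assumes subspace_A: "subspace (A n)"
    and d_add: "x \<in> A n \<Longrightarrow> y \<in> A n \<Longrightarrow> d n (x + y) = d n x + d n y"
    and d_scale: "x \<in> A n \<Longrightarrow> d n (s k x) = s k (d n x)"
begin

lemma d_zero: "d n 0 = 0"
  using d_scale[OF subspace_0[OF subspace_A], of n 0] by simp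

lemma subspace_cocycles: "subspace (cocycles A d n)"
  unfolding subspace_def cocycles_def
  by (auto simp: d_zero d_add d_scale intro: subspace_A subspace_0 subspace_add subspace_scale)

lemma subspace_coboundaries: "subspace (coboundaries A d n)"
proof (cases n)
  case 0
  then show ?thesis by (simp add: coboundaries_def)
next
  case (Suc j)
  have "0 \<in> d j ` A j"
    using subspace_0[OF subspace_A] d_zero by (metis imageI)
  moreover have "x + y \<in> d j ` A j" if "x \<in> d j ` A j" "y \<in> d j ` A j" for x y
    using that by (auto simp: d_add[symmetric] intro!: imageI subspace_add[OF subspace_A])
  moreover have "s k x \<in> d j ` A j" if "x \<in> d j ` A j" for k x
    using that by (auto simp: d_scale[symmetric] intro!: imageI subspace_scale[OF subspace_A])
  ultimately show ?thesis
    unfolding subspace_def coboundaries_def by (simp add: Suc)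
qed

lemma cohomology_class_eq_iff:
  "cohomology_class A d n x = cohomology_class A d n y \<longleftrightarrow> x - y \<in> coboundaries A d n"
proof
  assume "cohomology_class A d n x = cohomology_class A d n y"
  moreover have "x \<in> cohomology_class A d n x"
    using subspace_0[OF subspace_coboundaries, of n] unfolding cohomology_class_def elt_set_plus_def
    by force
  ultimately show "x - y \<in> coboundaries A d n"
    unfolding cohomology_class_def elt_set_plus_def by auto
next
  have le: "cohomology_class A d n x \<subseteq> cohomology_class A d n y"
    if xy: "x - y \<in> coboundaries A d n" for x y
  proof
    fix z assume "z \<in> cohomology_class A d n x"
    then obtain b where b: "b \<in> coboundaries A d n" "z = y + ((x - y) + b)"
      unfolding cohomology_class_def elt_set_plus_def by auto
    then show "z \<in> cohomology_class A d n y"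
      using subspace_add[OF subspace_coboundaries xy b(1)]
      unfolding cohomology_class_def elt_set_plus_def by blast
  qed
  assume xy: "x - y \<in> coboundaries A d n"
  then have "y - x \<in> coboundaries A d n"
    using subspace_neg[OF subspace_coboundaries xy] by simp
  with xy show "cohomology_class A d n x = cohomology_class A d n y"
    using le by blast
qed

lemma cohomology_class_add:
  "cohomology_class A d n x + cohomology_class A d n y = cohomology_class A d n (x + y)"
proof -
  have "coboundaries A d n + coboundaries A d n = coboundaries A d n"
    using subspace_0[OF subspace_coboundaries, of n] subspace_add[OF subspace_coboundaries]
    by (force simp: set_plus_def)
  then show ?thesis
    by (simp add: cohomology_class_def set_plus_rearrange)
qed

lemma cohomology_scale_class:
  "cohomology_scale s A d n k (cohomology_class A d n x) = cohomology_class A d n (s k x)"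
proof -
  have "s k x + b \<in> cohomology_scale s A d n k (cohomology_class A d n x)"
    if "b \<in> coboundaries A d n" for b
  proof -
    have "x + 0 \<in> cohomology_class A d n x"
      unfolding cohomology_class_def elt_set_plus_def
      using subspace_0[OF subspace_coboundaries] by blast
    then show ?thesis
      using that unfolding cohomology_scale_def by (force simp: set_plus_def)
  qed
  moreover have "s k (x + b) + b' \<in> cohomology_class A d n (s k x)"
    if "b \<in> coboundaries A d n" "b' \<in> coboundaries A d n" for b b'
    using subspace_add[OF subspace_coboundaries subspace_scale[OF subspace_coboundaries that(1)] that(2)]
    unfolding cohomology_class_def elt_set_plus_def by (auto simp: scale_right_distrib add.assoc)
  ultimately show ?thesis
    unfolding cohomology_scale_def cohomology_class_def
    by (auto simp: set_plus_def elt_set_plus_def)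
qed

end

text \<open>
  The map on classes has to pick a representative.  Two representatives differ by a coboundary, and
  \<open>F\<close> maps coboundaries to coboundaries, so the choice does not matter.  The nonzero scalar \<open>\<epsilon> n\<close>
  allows for maps that commute with the differentials only up to sign.
\<close>

proposition cochain_map_induces_morphism:
  assumes "linear_differentials s A d" and "linear_differentials s' A' d'"
    and F_mem: "\<And>n x. x \<in> A n \<Longrightarrow> F n x \<in> A' (n + p)"
    and F_add: "\<And>n x y. x \<in> A n \<Longrightarrow> y \<in> A n \<Longrightarrow> F n (x + y) = F n x + F n y"
    and F_scale: "\<And>n k x. x \<in> A n \<Longrightarrow> F n (s k x) = s' k (F n x)"
    and \<epsilon>: "\<And>n. \<epsilon> n \<noteq> 0"
    and F_d: "\<And>n x. x \<in> A n \<Longrightarrow> F (Suc n) (d n x) = s' (\<epsilon> n) (d' (n + p) (F n x))"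
  shows "\<exists>Phi. cohomology_morphism p s A d s' A' d' Phi \<and> induces_on_cohomology p A d A' d' F Phi"
proof -
  interpret A: linear_differentials s A d by fact
  interpret A': linear_differentials s' A' d' by fact
  have F0: "F n 0 = 0" for n
    using F_scale[OF A.subspace_0[OF A.subspace_A], of n 0] by simp
  \<comment> \<open>Here \<open>\<epsilon> n \<noteq> 0\<close> is needed: \<open>d' (F z)\<close> is only known to vanish after multiplication by it.\<close>
  have F_cocycle: "F n z \<in> cocycles A' d' (n + p)" if "z \<in> cocycles A d n" for n z
    using that F_d[of z n] \<epsilon>[of n] F_mem[of z n] by (simp add: cocycles_def F0)
  have F_coboundary: "F n b \<in> coboundaries A' d' (n + p)" if b: "b \<in> coboundaries A d n" for n b
  proof (cases n)
    case 0
    then show ?thesis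
      using b A'.subspace_0[OF A'.subspace_coboundaries] by (simp add: coboundaries_def F0)
  next
    case (Suc j)
    then obtain x where x: "x \<in> A j" "b = d j x" using b by (auto simp: coboundaries_def)
    have "d' (j + p) (F j x) \<in> coboundaries A' d' (n + p)"
      using F_mem[OF x(1)] by (simp add: coboundaries_def Suc)
    then show ?thesis
      using A'.subspace_scale[OF A'.subspace_coboundaries] F_d[OF x(1)] by (simp add: Suc x(2))
  qed
  define Phi where "Phi n X =
    cohomology_class A' d' (n + p) (F n (SOME z. z \<in> cocycles A d n \<and> X = cohomology_class A d n z))"
    for n X
  have Phi: "Phi n (cohomology_class A d n z) = cohomology_class A' d' (n + p) (F n z)"
    if z: "z \<in> cocycles A d n" for n z
  proof -
    define y where "y = (SOME y. y \<in> cocycles A d n \<and> cohomology_class A d n z = cohomology_class A d n y)"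
    have "y \<in> cocycles A d n \<and> cohomology_class A d n z = cohomology_class A d n y"
      unfolding y_def by (rule someI[of _ z]) (simp add: z)
    then have y: "y \<in> cocycles A d n" "cohomology_class A d n z = cohomology_class A d n y"
      by auto
    then have zy: "z - y \<in> coboundaries A d n" by (simp add: A.cohomology_class_eq_iff)
    have mem: "y \<in> A n" "z - y \<in> A n"
      using z y(1) A.subspace_diff[OF A.subspace_A] by (auto simp: cocycles_def)
    have "F n z = F n (z - y) + F n y" using F_add[OF mem(2,1)] by simp
    then have "F n y - F n z = - F n (z - y)" by simp
    then have "F n y - F n z \<in> coboundaries A' d' (n + p)"
      using A'.subspace_neg[OF A'.subspace_coboundaries F_coboundary[OF zy]] by simp
    then show ?thesis
      unfolding Phi_def y_def[symmetric] by (simp add: A'.cohomology_class_eq_iff)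
  qed
  have "cohomology_morphism p s A d s' A' d' Phi"
    unfolding cohomology_morphism_def cohomology_def
  proof (intro allI conjI ballI)
    fix n
    show "Phi n ` cohomology_class A d n ` cocycles A d n
        \<subseteq> cohomology_class A' d' (n + p) ` cocycles A' d' (n + p)"
      using Phi F_cocycle by auto
  next
    fix n X Y
    assume "X \<in> cohomology_class A d n ` cocycles A d n" "Y \<in> cohomology_class A d n ` cocycles A d n"
    then obtain x y where xy: "x \<in> cocycles A d n" "y \<in> cocycles A d n"
      "X = cohomology_class A d n x" "Y = cohomology_class A d n y" by auto
    moreover have "x \<in> A n" "y \<in> A n" using xy by (auto simp: cocycles_def)
    ultimately show "Phi n (X + Y) = Phi n X + Phi n Y"
      using A.subspace_add[OF A.subspace_cocycles xy(1,2)]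
      by (simp add: A.cohomology_class_add A'.cohomology_class_add Phi F_add)
  next
    fix n k X
    assume "X \<in> cohomology_class A d n ` cocycles A d n"
    then obtain x where x: "x \<in> cocycles A d n" "X = cohomology_class A d n x" by auto
    moreover have "x \<in> A n" using x by (auto simp: cocycles_def)
    ultimately show "Phi n (cohomology_scale s A d n k X) =
        cohomology_scale s' A' d' (n + p) k (Phi n X)"
      using A.subspace_scale[OF A.subspace_cocycles x(1)]
      by (simp add: A.cohomology_scale_class A'.cohomology_scale_class Phi F_scale)
  qed
  moreover have "induces_on_cohomology p A d A' d' F Phi"
    unfolding induces_on_cohomology_def using F_mem F_cocycle F_coboundary Phi by auto
  ultimately show ?thesis by blast
qed

section \<open>Tensor products of two maps\<close>

context two_spaces
begin

context
  notes pointwise [simp del]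
begin

lemma tscale_add_right [simp]:
  "tscale k (s + t) = tscale k s + tscale k (t :: ('k, 'c, 'm) tensor)"
  by (simp add: fun_eq_iff pointwise algebra_simps)

lemma tscale_0_right [simp]: "tscale k (0 :: ('k, 'c, 'm) tensor) = 0"
  by (simp add: fun_eq_iff pointwise)

lemma tscale_0_left [simp]: "tscale 0 (t :: ('k, 'c, 'm) tensor) = 0"
  by (simp add: fun_eq_iff pointwise)

lemma tscale_tscale: "tscale k (tscale l (t :: ('k, 'c, 'm) tensor)) = tscale (k * l) t"
  by (simp add: fun_eq_iff pointwise mult.assoc)

lemma tscale_sum: "tscale k (\<Sum>i\<in>I. t i :: ('k, 'c, 'm) tensor) = (\<Sum>i\<in>I. tscale k (t i))"
  by (induction I rule: infinite_finite_induct) simp_all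

lemma listset_append: "u \<in> listset As \<Longrightarrow> v \<in> listset Bs \<Longrightarrow> u @ v \<in> listset (As @ Bs)"
  by (induction As arbitrary: u) (auto simp: set_Cons_def)

lemma subspace_tensor_space: "module.subspace tscale (tensor_space As)"
  unfolding tensor_space_def
  using vector_space_tscale by (metis module_iff_vector_space module.subspace_span)

lemma tensor_space_closed:
  "0 \<in> tensor_space As"
  "s \<in> tensor_space As \<Longrightarrow> t \<in> tensor_space As \<Longrightarrow> s + t \<in> tensor_space As"
  "t \<in> tensor_space As \<Longrightarrow> tscale k t \<in> tensor_space As"
  using subspace_tensor_space
  unfolding module.subspace_def[OF module_iff_vector_space[THEN iffD2, OF vector_space_tscale]]
  by auto

lemma tconc_tensor_space:
  assumes s: "s \<in> tensor_space As" and t: "t \<in> tensor_space Bs"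
  shows "s \<odot> t \<in> tensor_space (As @ Bs)"
  using s unfolding tensor_space_def[of As]
proof (induction rule: Tens_induct)
  case zero
  then show ?case by (simp add: tensor_space_closed)
next
  case (step k u s)
  have "tprod u \<odot> t \<in> tensor_space (As @ Bs)"
    using t unfolding tensor_space_def[of Bs]
  proof (induction rule: Tens_induct)
    case zero
    then show ?case by (simp add: tconc_right tensor_space_closed)
  next
    case (step l v t)
    have "t \<in> Tens" using step(2) tensor_space_Tens[of Bs] by (auto simp: tensor_space_def)
    then show ?case
      using step \<open>u \<in> listset As\<close>
      by (simp add: tconc_right tensor_space_closed tprod_in_tensor_space listset_append)
  qed
  then show ?case using step by (simp add: tensor_space_closed)
qed

lemma letter_homD:
  "letter_hom g \<Longrightarrow> g x \<in> Tens"
  by (auto simp: letter_hom_def)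

lemma letter_hom_iff:
  "letter_hom g \<longleftrightarrow> (\<forall>x. g x \<in> Tens) \<and>
    (\<forall>x y. g (Inl (x + y)) = g (Inl x) + g (Inl y)) \<and> (\<forall>k x. g (Inl (sC k x)) = tscale k (g (Inl x))) \<and>
    (\<forall>x y. g (Inr (x + y)) = g (Inr x) + g (Inr y)) \<and> (\<forall>k x. g (Inr (sM k x)) = tscale k (g (Inr x)))"
  using C.vector_space_axioms M.vector_space_axioms vector_space_tscale
  unfolding letter_hom_def linear_iff' by (auto simp: image_subset_iff)

lemma tscale_commute: "tscale k (tscale l t) = tscale l (tscale k (t :: ('k, 'c, 'm) tensor))"
  by (simp add: fun_eq_iff pointwise mult.left_commute)

lemma letter_hom_zero: "letter_hom (\<lambda>x. 0)"
  by (simp add: letter_hom_iff)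

lemma letter_hom_add: "letter_hom g \<Longrightarrow> letter_hom h \<Longrightarrow> letter_hom (\<lambda>x. g x + h x)"
  by (simp add: letter_hom_iff algebra_simps)

lemma letter_hom_scale: "letter_hom g \<Longrightarrow> letter_hom (\<lambda>x. tscale k (g x))"
  by (simp add: letter_hom_iff tscale_commute)

lemma letter_hom_sum: "(\<And>i. i \<in> I \<Longrightarrow> letter_hom (g i)) \<Longrightarrow> letter_hom (\<lambda>x. \<Sum>i\<in>I. g i x)"
  by (induction I rule: infinite_finite_induct) (auto simp: letter_hom_zero letter_hom_add)

lemma letter_hom_tmap:
  "letter_hom h \<Longrightarrow> \<forall>g\<in>set gs. letter_hom g \<Longrightarrow> letter_hom (\<lambda>x. tmap gs (h x))"
  by (simp add: letter_hom_iff[of h] letter_hom_iff[of "\<lambda>x. tmap gs (h x)"] tmap_Tens tmap_linear)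

text \<open>
  The comparison of the differentials is carried out in \<open>tmap [g, h] t\<close>, with \<open>t\<close> in the image of a
  coaction.  This is bilinear in \<open>g\<close> and \<open>h\<close>, and longer tensors are the values of \<open>g\<close> and \<open>h\<close>.
\<close>

lemma tword_pair:
  assumes "letter_hom g" "letter_hom h"
  shows "tword [g, h] w = (if length w = 2 then g (w ! 0) \<odot> h (w ! 1) else 0)"
proof (cases w)
  case (Cons x w')
  then show ?thesis
    using assms by (cases w'; cases "tl w'") (auto simp: tconc_right letter_homD)
qed simp

lemma tmap_pair_add:
  assumes "t \<in> Tens" "letter_hom g" "letter_hom g'" "letter_hom h"
  shows "tmap [\<lambda>x. g x + g' x, h] t = tmap [g, h] t + tmap [g', h] t"
    and "tmap [h, \<lambda>x. g x + g' x] t = tmap [h, g] t + tmap [h, g'] t"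
  using assms(1)
  by (induction rule: Tens_induct)
     (use assms(2-4) in \<open>simp_all add: tmap_linear tmap_tprod letter_hom_add tword_pair
        tconc_right letter_homD\<close>)

lemma tmap_pair_scale:
  assumes "t \<in> Tens" "letter_hom g" "letter_hom h"
  shows "tmap [\<lambda>x. tscale k (g x), h] t = tscale k (tmap [g, h] t)"
    and "tmap [h, \<lambda>x. tscale k (g x)] t = tscale k (tmap [h, g] t)"
  using assms(1)
  by (induction rule: Tens_induct)
     (use assms(2-3) in \<open>simp_all add: tmap_linear tmap_tprod letter_hom_scale tword_pair
        tconc_right letter_homD tscale_commute\<close>)

lemma tmap_pair_sum:
  assumes "t \<in> Tens" "\<And>i. i \<in> I \<Longrightarrow> letter_hom (g i)" "letter_hom h"
  shows "tmap [\<lambda>x. \<Sum>i\<in>I. g i x, h] t = (\<Sum>i\<in>I. tmap [g i, h] t)"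
    and "tmap [h, \<lambda>x. \<Sum>i\<in>I. g i x] t = (\<Sum>i\<in>I. tmap [h, g i] t)"
proof -
  have zero: "tmap [\<lambda>x. 0, h] t = 0" "tmap [h, \<lambda>x. 0] t = 0"
    using tmap_pair_scale[OF assms(1) letter_hom_zero assms(3), of 0]
    by (simp_all add: tscale_0_left)
  have "tmap [\<lambda>x. \<Sum>i\<in>I. g i x, h] t = (\<Sum>i\<in>I. tmap [g i, h] t) \<and>
    tmap [h, \<lambda>x. \<Sum>i\<in>I. g i x] t = (\<Sum>i\<in>I. tmap [h, g i] t)"
    using assms(2)
    by (induction I rule: infinite_finite_induct)
       (simp_all add: zero tmap_pair_add[OF assms(1) _ letter_hom_sum assms(3)])
  then show "tmap [\<lambda>x. \<Sum>i\<in>I. g i x, h] t = (\<Sum>i\<in>I. tmap [g i, h] t)"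
    "tmap [h, \<lambda>x. \<Sum>i\<in>I. g i x] t = (\<Sum>i\<in>I. tmap [h, g i] t)" by auto
qed

lemma tmap_pair_cong:
  assumes t: "t \<in> tensor_space [X, Y]"
    and "letter_hom g" "letter_hom g'" "letter_hom h" "letter_hom h'"
    and "\<And>x. x \<in> X \<Longrightarrow> g x = g' x" "\<And>y. y \<in> Y \<Longrightarrow> h y = h' y"
  shows "tmap [g, h] t = tmap [g', h'] t"
  by (rule tensor_eqI[OF t])
     (use assms(2-) in \<open>auto simp: tmap_linear tmap_tprod set_Cons_def\<close>)

lemma tmap_single: "letter_hom g \<Longrightarrow> tmap [g] (idt x) = g x"
  by (simp add: idt_def tmap_tprod letter_homD)

lemma tmap_replicate_idt:
  assumes "t \<in> tensor_space As" "length As = n"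
  shows "tmap (replicate n idt) t = t"
proof (rule tensor_eqI[OF assms(1)])
  fix w assume "w \<in> listset As"
  then have "length w = n" using assms(2) by (simp add: length_listset)
  then have "tword (replicate n idt) w = tprod w"
    by (induction w arbitrary: n) (auto simp: idt_def)
  then show "tmap (replicate n idt) (tprod w) = tprod w"
    by (simp add: tmap_tprod letter_hom_intros)
qed (simp_all add: tmap_linear)

text \<open>
  Functoriality of the tensor product, for maps whose values have several factors.  The lengths of
  the values of \<open>h1\<close> decide where the list of outer maps is cut into \<open>gs1\<close> and \<open>gs2\<close>.
\<close>

lemma tmap_blocks:
  assumes t: "t \<in> tensor_space [X, Y]"
    and h: "letter_hom h1" "letter_hom h2"
    and gs: "\<forall>g\<in>set gs1. letter_hom g" "\<forall>g\<in>set gs2. letter_hom g"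
    and block: "\<And>x. x \<in> X \<Longrightarrow> h1 x \<in> tensor_space Bs" "length Bs = length gs1"
  shows "tmap (gs1 @ gs2) (tmap [h1, h2] t) = tmap [\<lambda>x. tmap gs1 (h1 x), \<lambda>x. tmap gs2 (h2 x)] t"
proof (rule tensor_eqI[OF t])
  fix w assume "w \<in> listset [X, Y]"
  then obtain x y where w: "w = [x, y]" "x \<in> X" by (auto simp: set_Cons_def)
  then show "tmap (gs1 @ gs2) (tmap [h1, h2] (tprod w)) =
      tmap [\<lambda>x. tmap gs1 (h1 x), \<lambda>x. tmap gs2 (h2 x)] (tprod w)"
    using h gs tmap_append[OF gs block(1)[OF w(2)] block(2), of "h2 y"]
    by (simp add: tmap_tprod letter_hom_tmap letter_homD tmap_Tens)
qed (simp_all add: tmap_linear)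

lemma idt_block: "idt x \<in> tensor_space [UNIV]"
  unfolding idt_def by (rule tprod_in_tensor_space) (simp add: set_Cons_def)

text \<open>
  Each of the three bicomodule laws has the form of the assumption \<open>eq\<close>.  Applying \<open>u \<otimes> v \<otimes> w\<close> to
  both sides and composing factorwise gives a law between tensors with two factors, in which \<open>u\<close>,
  \<open>v\<close>, \<open>w\<close> may take values of any length.
\<close>

lemma coassociativity_sweedler:
  assumes t: "t \<in> tensor_space [X, Y]" and t': "t' \<in> tensor_space [X', Y']"
    and D: "letter_hom D" "letter_hom D'" "\<And>x. x \<in> X \<Longrightarrow> D x \<in> tensor_space [P, Q]"
    and eq: "tmap [D, idt] t = tmap [idt, D'] t'"
    and uvw: "letter_hom u" "letter_hom v" "letter_hom w"
  shows "tmap [\<lambda>x. tmap [u, v] (D x), w] t = tmap [u, \<lambda>x. tmap [v, w] (D' x)] t'"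
proof -
  have "tmap [\<lambda>x. tmap [u, v] (D x), w] t = tmap ([u, v] @ [w]) (tmap [D, idt] t)"
    by (subst tmap_blocks[OF t]) (use D uvw in \<open>auto simp: letter_hom_intros tmap_single\<close>)
  also have "\<dots> = tmap ([u] @ [v, w]) (tmap [idt, D'] t')" by (simp add: eq)
  also have "\<dots> = tmap [u, \<lambda>x. tmap [v, w] (D' x)] t'"
    by (subst tmap_blocks[OF t' _ _ _ _ idt_block])
       (use D uvw in \<open>auto simp: letter_hom_intros tmap_single\<close>)
  finally show ?thesis .
qed

text \<open>
  Maps on letters are extended by zero to the letters from the other space, so composites of them
  need to be computed only on the letters that occur in \<open>t\<close>.
\<close>

lemma tmap_blocks_eq:
  assumes t: "t \<in> tensor_space [X, Y]"
    and h: "letter_hom h1" "letter_hom h2"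
    and gs: "\<forall>g\<in>set gs1. letter_hom g" "\<forall>g\<in>set gs2. letter_hom g"
    and block: "\<And>x. x \<in> X \<Longrightarrow> h1 x \<in> tensor_space Bs" "length Bs = length gs1"
    and k: "letter_hom k1" "letter_hom k2"
    and eq: "\<And>x. x \<in> X \<Longrightarrow> tmap gs1 (h1 x) = k1 x" "\<And>y. y \<in> Y \<Longrightarrow> tmap gs2 (h2 y) = k2 y"
  shows "tmap (gs1 @ gs2) (tmap [h1, h2] t) = tmap [k1, k2] t"
proof -
  have "tmap (gs1 @ gs2) (tmap [h1, h2] t) = tmap [\<lambda>x. tmap gs1 (h1 x), \<lambda>x. tmap gs2 (h2 x)] t"
    by (rule tmap_blocks[OF t h gs block])
  also have "\<dots> = tmap [k1, k2] t"
    by (rule tmap_pair_cong[OF t _ k(1) _ k(2) eq]) (use h gs in \<open>simp_all add: letter_hom_tmap\<close>)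
  finally show ?thesis .
qed

lemma onC_tmap: "onC (\<lambda>c. tmap gs (g c)) = (\<lambda>x. tmap gs (onC g x))"
  by (auto simp: onC_def fun_eq_iff tmap_linear split: sum.splits)

lemma onM_tmap: "onM (\<lambda>m. tmap gs (g m)) = (\<lambda>x. tmap gs (onM g x))"
  by (auto simp: onM_def fun_eq_iff tmap_linear split: sum.splits)

lemma onM_add: "onM (\<lambda>m. g m + h m) = (\<lambda>x. onM g x + onM h x)"
  by (auto simp: onM_def fun_eq_iff split: sum.splits)

lemma onM_scale: "onM (\<lambda>m. tscale k (g m)) = (\<lambda>x. tscale k (onM g x))"
  by (rule ext) (simp add: onM_def split: sum.splits)

lemma onM_sum: "onM (\<lambda>m. \<Sum>i\<in>I. g i m) = (\<lambda>x. \<Sum>i\<in>I. onM (g i) x)"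
  by (rule ext) (simp add: onM_def split: sum.splits)

lemma onC_add: "onC (\<lambda>m. g m + h m) = (\<lambda>x. onC g x + onC h x)"
  by (auto simp: onC_def fun_eq_iff split: sum.splits)

lemma onC_scale: "onC (\<lambda>m. tscale k (g m)) = (\<lambda>x. tscale k (onC g x))"
  by (rule ext) (simp add: onC_def split: sum.splits)

lemma onC_sum: "onC (\<lambda>m. \<Sum>i\<in>I. g i m) = (\<lambda>x. \<Sum>i\<in>I. onC (g i) x)"
  by (rule ext) (simp add: onC_def split: sum.splits)

lemma tmap_map_letter: "letter_hom (onM g) \<Longrightarrow> tmap [onM g] (map_letter T (Inl c)) = g (T c)"
  by (simp add: map_letter_def tmap_single)

lemma homC_closed:
  "0 \<in> homC As" "f \<in> homC As \<Longrightarrow> g \<in> homC As \<Longrightarrow> f + g \<in> homC As"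
  "f \<in> homC As \<Longrightarrow> pscale tscale k f \<in> homC As"
  using C.vector_space_axioms vector_space_tscale
  by (auto simp: homC_def linear_iff' plus_fun_apply zero_fun_apply pscale_apply[of tscale]
      tscale_commute tensor_space_closed image_subset_iff algebra_simps)

lemma homM_closed:
  "0 \<in> homM As" "f \<in> homM As \<Longrightarrow> g \<in> homM As \<Longrightarrow> f + g \<in> homM As"
  "f \<in> homM As \<Longrightarrow> pscale tscale k f \<in> homM As"
  using M.vector_space_axioms vector_space_tscale
  by (auto simp: homM_def linear_iff' plus_fun_apply zero_fun_apply pscale_apply[of tscale]
      tscale_commute tensor_space_closed image_subset_iff algebra_simps)

lemma tmap_pair_homM:
  assumes t: "\<And>m. g m \<in> tensor_space [X, Y]" and g: "letter_hom (onM g)"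
    and h: "letter_hom h1" "letter_hom h2"
    and mem: "\<And>x. x \<in> X \<Longrightarrow> h1 x \<in> tensor_space As" "\<And>y. y \<in> Y \<Longrightarrow> h2 y \<in> tensor_space Bs"
  shows "(\<lambda>m. tmap [h1, h2] (g m)) \<in> homM (As @ Bs)"
proof -
  have "tmap [h1, h2] (g m) \<in> tensor_space (As @ Bs)" for m
  proof (rule tmap_tensor_space[OF t])
    fix w assume "w \<in> listset [X, Y]"
    then obtain x y where "w = [x, y]" "x \<in> X" "y \<in> Y" by (auto simp: set_Cons_def)
    then show "tword [h1, h2] w \<in> tensor_space (As @ Bs)"
      using h mem by (simp add: letter_homD tconc_tensor_space)
  qed (use h in auto)
  moreover have "letter_hom (onM (\<lambda>m. tmap [h1, h2] (g m)))"
    unfolding onM_tmap using g h by (simp add: letter_hom_tmap)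
  ultimately show ?thesis
    by (auto simp: letter_hom_def homM_def comp_def)
qed

end

end

section \<open>Linearity of the dendriform differential\<close>

lemma at_vec_bas: "at_vec \<sigma> (bas r) = \<sigma> r"
  by (simp add: at_vec_def pscale_def)

lemma at_vec_sum_bas:
  fixes \<sigma> :: "nat \<Rightarrow> 'x \<Rightarrow> ('k::field, 'c, 'm) tensor"
  shows "at_vec \<sigma> (\<Sum>j=1..n. bas j) = (\<lambda>m. \<Sum>j=1..n. \<sigma> j m)"
proof -
  let ?x = "\<Sum>j=1..n. bas j :: nat \<Rightarrow>\<^sub>0 'k"
  have l: "Poly_Mapping.lookup ?x r = (if r \<in> {1..n} then 1 else 0)" for r
    by (simp add: lookup_sum lookup_single when_def)
  then have "Poly_Mapping.keys ?x = {1..n}" by (auto simp: in_keys_iff split: if_splits)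
  then have "at_vec \<sigma> ?x m = (\<Sum>j=1..n. \<sigma> j m)" for m
    unfolding at_vec_def by (rule sum.cong) (simp add: l pscale_def del: One_nat_def)
  then show ?thesis by blast
qed

context dendriform_coalgebra
begin

context
  notes pointwise [simp del]
begin

lemma at_vec_add:
  "at_vec (\<sigma> + \<tau>) x = (\<lambda>m. at_vec \<sigma> x m + (at_vec \<tau> x m :: ('k, 'c, 'm) tensor))"
  unfolding at_vec_def plus_fun_apply[of \<sigma>] plus_fun_apply[of "\<sigma> r" for r]
  by (simp add: sum.distrib)

lemma at_vec_scale:
  "at_vec (pscale (pscale tscale) k \<sigma>) x = (\<lambda>m. tscale k (at_vec \<sigma> x m :: ('k, 'c, 'm) tensor))"
  unfolding at_vec_def pscale_apply[of "pscale tscale"] pscale_apply[of tscale]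
  by (simp add: tscale_sum tscale_commute)

lemma cochain_at_vec_hom:
  assumes "\<sigma> \<in> coDend_cochains n"
  shows "letter_hom (onM (at_vec \<sigma> x))"
proof -
  have "letter_hom (onM (\<sigma> r))" for r
  proof (cases "r \<in> {1..n}")
    case True
    then show ?thesis using assms letter_hom_intros(3) unfolding coDend_cochains_def by blast
  next
    case False
    then have "onM (\<sigma> r) = (\<lambda>x. 0)"
      using assms unfolding coDend_cochains_def by (auto simp: onM_def fun_eq_iff split: sum.splits)
    then show ?thesis by (simp add: letter_hom_zero)
  qed
  then show ?thesis
    unfolding at_vec_def onM_sum onM_scale by (intro letter_hom_sum letter_hom_scale)
qed

lemma comult_Tens: "comult r m \<in> Tens"
proof -
  have "prec m \<in> tensor_space [MM, MM]" "succ m \<in> tensor_space [MM, MM]"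
    using prec_hom succ_hom by (auto simp: homM_def)
  then show ?thesis using tensor_space_Tens[THEN subsetD] by (simp add: comult_def)
qed

lemma linear_differentials_coDend:
  "linear_differentials (pscale (pscale tscale)) coDend_cochains delta_c"
proof -
  let ?s = "pscale (pscale tscale) :: 'k \<Rightarrow> (nat \<Rightarrow> 'm \<Rightarrow> ('k, 'c, 'm) tensor) \<Rightarrow> _"
  interpret V: vector_space ?s
    by (intro vector_space_pscale vector_space_field)
  have *: "(\<sigma> + \<tau>) r = \<sigma> r + \<tau> r" "?s k \<sigma> r = pscale tscale k (\<sigma> r)" "(0 :: nat \<Rightarrow> 'm \<Rightarrow> ('k, 'c, 'm) tensor) r = 0"
    for \<sigma> \<tau> :: "nat \<Rightarrow> 'm \<Rightarrow> ('k, 'c, 'm) tensor" and r k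
    by (simp_all add: pointwise)
  have zero: "(\<lambda>_. 0) = (0 :: 'm \<Rightarrow> ('k, 'c, 'm) tensor)" by (simp add: fun_eq_iff pointwise)
  have pscale_zero: "pscale tscale k 0 = (0 :: 'm \<Rightarrow> ('k, 'c, 'm) tensor)" for k
    by (simp add: fun_eq_iff pointwise)
  show ?thesis
  proof
    fix n
    show "V.subspace (coDend_cochains n)"
      unfolding V.subspace_def coDend_cochains_def mem_Collect_eq * zero
      by (auto simp: homM_closed pscale_zero)
  next
    fix \<sigma> \<tau> n assume st: "\<sigma> \<in> coDend_cochains n" "\<tau> \<in> coDend_cochains n"
    note lh = cochain_at_vec_hom[OF st(1)] cochain_at_vec_hom[OF st(2)]
    have "delta_c n (\<sigma> + \<tau>) r m = delta_c n \<sigma> r m + delta_c n \<tau> r m" for r m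
      unfolding delta_c_def at_vec_add onM_add
      by (simp add: * plus_fun_apply[of "\<sigma> _"] tmap_pair_add tmap_linear comult_Tens lh letter_hom_intros(1)
          sum.distrib algebra_simps)
    then show "delta_c n (\<sigma> + \<tau>) = delta_c n \<sigma> + delta_c n \<tau>"
      by (simp add: fun_eq_iff pointwise)
  next
    fix \<sigma> n k assume s: "\<sigma> \<in> coDend_cochains n"
    have "delta_c n (?s k \<sigma>) r m = tscale k (delta_c n \<sigma> r m)" for r m
      unfolding delta_c_def at_vec_scale onM_scale
      by (simp add: * pscale_apply[of tscale] tmap_pair_scale tmap_linear comult_Tens cochain_at_vec_hom[OF s]
          letter_hom_intros(1) tscale_sum tscale_commute)
    then show "delta_c n (?s k \<sigma>) = ?s k (delta_c n \<sigma>)"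
      by (simp add: fun_eq_iff pointwise)
  qed
qed

end

end

section \<open>Sweedler calculus for a relative Rota-Baxter operator\<close>

lemma sum_first: "(\<Sum>i=1..n+1. g i) = g 1 + (\<Sum>i=1..n. g (Suc i))"
  for g :: "nat \<Rightarrow> 'a::comm_monoid_add"
  by (induction n) (simp_all add: add.assoc)

lemma sum_last: "(\<Sum>i=1..n+1. g i) = (\<Sum>i=1..n. g i) + g (n + 1)"
  for g :: "nat \<Rightarrow> 'a::comm_monoid_add"
  by simp

context relative_rota_baxter
begin

context
  notes pointwise [simp del]
begin

declare letter_homs [simp] letter_homs_dend [simp]

lemma coaction_spaces:
  "Delta c \<in> tensor_space [CC, CC]" "Dl m \<in> tensor_space [CC, MM]" "Dr m \<in> tensor_space [MM, CC]"
  using Delta_hom Dl_hom Dr_hom by (auto simp: homC_def homM_def)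

lemma coaction_Tens [simp]: "Delta c \<in> Tens" "Dl m \<in> Tens" "Dr m \<in> Tens" "prec m \<in> Tens" "succ m \<in> Tens"
  by (simp_all add: coaction_spaces[THEN tensor_space_Tens[THEN subsetD]] prec_def succ_def tmap_Tens)

lemma onM_prec: "onM prec = (\<lambda>x. tmap [idt, map_letter T] (onM Dr x))"
  using onM_tmap[of "[idt, map_letter T]" Dr] by (simp add: prec_def[abs_def])

lemma onM_succ: "onM succ = (\<lambda>x. tmap [map_letter T, idt] (onM Dl x))"
  using onM_tmap[of "[map_letter T, idt]" Dl] by (simp add: succ_def[abs_def])

lemma sweedler_r:
  assumes "letter_hom u" "letter_hom v" "letter_hom w"
  shows "tmap [\<lambda>x. tmap [u, v] (onM Dr x), w] (Dr m) = tmap [u, \<lambda>x. tmap [v, w] (onC Delta x)] (Dr m)"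
  by (rule coassociativity_sweedler[OF coaction_spaces(3) coaction_spaces(3) _ _ _ bicomodule_r assms])
     (auto intro: coaction_spaces)

lemma sweedler_l:
  assumes "letter_hom u" "letter_hom v" "letter_hom w"
  shows "tmap [\<lambda>x. tmap [u, v] (onC Delta x), w] (Dl m) = tmap [u, \<lambda>x. tmap [v, w] (onM Dl x)] (Dl m)"
  by (rule coassociativity_sweedler[OF coaction_spaces(2) coaction_spaces(2) _ _ _ bicomodule_l assms])
     (auto intro: coaction_spaces)

lemma sweedler_lr:
  assumes "letter_hom u" "letter_hom v" "letter_hom w"
  shows "tmap [\<lambda>x. tmap [u, v] (onM Dl x), w] (Dr m) = tmap [u, \<lambda>x. tmap [v, w] (onM Dr x)] (Dl m)"
  by (rule coassociativity_sweedler[OF coaction_spaces(3) coaction_spaces(2) _ _ _ bicomodule_lr assms])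
     (auto intro: coaction_spaces)

lemma homC_MM:
  assumes "f \<in> homC (replicate n MM)"
  shows "f c \<in> tensor_space (replicate n MM)" "letter_hom (onC f)"
    "tmap (replicate n idt) (f c) = f c"
proof -
  show f: "f c \<in> tensor_space (replicate n MM)"
    using assms by (auto simp: homC_def)
  show "tmap (replicate n idt) (f c) = f c"
    by (rule tmap_replicate_idt[OF f]) simp
  show "letter_hom (onC f)"
    using assms by (rule letter_hom_intros)
qed

lemma comp_T_hom: "letter_hom (onM g) \<Longrightarrow> letter_hom (onC (\<lambda>c. g (T c)))"
proof -
  assume g: "letter_hom (onM g)"
  have "onC (\<lambda>c. g (T c)) = (\<lambda>x. tmap [onM g] (map_letter T x))"
    by (rule ext) (auto simp: onC_def map_letter_def tmap_single g tmap_linear split: sum.splits)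
  then show ?thesis using g by (simp add: letter_hom_tmap)
qed

lemma map_letter_block: "map_letter T x \<in> tensor_space [UNIV]"
  by (cases x) (simp_all add: map_letter_def idt_block tensor_space_closed)

lemma tmap_idt_map_letter: "tmap [idt] (map_letter T x) = map_letter T x"
  using tmap_replicate_idt[OF map_letter_block, of 1] by simp

text \<open>
  In the next six lemmas the map \<open>T\<close>, applied to one factor of a coaction or of \<open>Delta\<close>, is composed
  with the map that acts on the same factor afterwards.
\<close>

lemma prec_right:
  assumes "letter_hom (onM g)"
  shows "tmap [idt, onM g] (prec m) = tmap [idt, onC (\<lambda>c. g (T c))] (Dr m)"
  unfolding prec_def
  by (rule tmap_blocks_eq[OF coaction_spaces(3), of _ _ "[idt]" "[onM g]" "[UNIV]", unfolded append.simps])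
     (use assms in \<open>auto simp: comp_T_hom idt_block tmap_single tmap_map_letter tmap_idt_map_letter\<close>)

lemma prec_left:
  assumes "letter_hom g"
  shows "tmap [g, idt] (prec m) = tmap [g, map_letter T] (Dr m)"
  unfolding prec_def
  by (rule tmap_blocks_eq[OF coaction_spaces(3), of _ _ "[g]" "[idt]" "[UNIV]", unfolded append.simps])
     (use assms in \<open>auto simp: comp_T_hom idt_block tmap_single tmap_map_letter tmap_idt_map_letter\<close>)

lemma succ_left:
  assumes "letter_hom (onM g)"
  shows "tmap [onM g, idt] (succ m) = tmap [onC (\<lambda>c. g (T c)), idt] (Dl m)"
  unfolding succ_def
  by (rule tmap_blocks_eq[OF coaction_spaces(2), of _ _ "[onM g]" "[idt]" "[UNIV]", unfolded append.simps])
     (use assms in \<open>auto simp: comp_T_hom map_letter_block tmap_single tmap_map_letter tmap_idt_map_letter\<close>)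

lemma succ_right:
  assumes "letter_hom g"
  shows "tmap [idt, g] (succ m) = tmap [map_letter T, g] (Dl m)"
  unfolding succ_def
  by (rule tmap_blocks_eq[OF coaction_spaces(2), of _ _ "[idt]" "[g]" "[UNIV]", unfolded append.simps])
     (use assms in \<open>auto simp: comp_T_hom map_letter_block tmap_single tmap_map_letter tmap_idt_map_letter\<close>)

lemma Delta_left:
  assumes "letter_hom g"
  shows "tmap [g, idt] (tmap [idt, map_letter T] (Delta c)) = tmap [g, map_letter T] (Delta c)"
  by (rule tmap_blocks_eq[OF coaction_spaces(1), of _ _ "[g]" "[idt]" "[UNIV]", unfolded append.simps])
     (use assms in \<open>auto simp: comp_T_hom idt_block tmap_single tmap_map_letter tmap_idt_map_letter\<close>)

lemma Delta_right:
  assumes "letter_hom g"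
  shows "tmap [idt, g] (tmap [map_letter T, idt] (Delta c)) = tmap [map_letter T, g] (Delta c)"
  by (rule tmap_blocks_eq[OF coaction_spaces(1), of _ _ "[idt]" "[g]" "[UNIV]", unfolded append.simps])
     (use assms in \<open>auto simp: comp_T_hom map_letter_block tmap_single tmap_map_letter tmap_idt_map_letter\<close>)

definition dend_at :: "nat \<Rightarrow> nat \<Rightarrow> ('c + 'm \<Rightarrow> ('k, 'c, 'm) tensor) list"
  where "dend_at n i = replicate (i - 1) idt @ [onM (\<lambda>m. prec m + succ m)] @ replicate (n - i) idt"

lemma dend_at_hom: "\<forall>h\<in>set (dend_at n i). letter_hom h"
  by (auto simp: dend_at_def)

section \<open>Comparison of the differentials\<close>

context
  fixes n f
  assumes f: "f \<in> homC (replicate n MM)"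
begin

lemma f_hom [simp]: "letter_hom (onC f)"
  by (rule homC_MM[OF f])

lemma Dr_outer:
  assumes g: "letter_hom g"
  shows "tmap ([g] @ replicate n idt) (tmap [idt, onC f] (Dr m)) = tmap [g, onC f] (Dr m)"
  by (rule tmap_blocks_eq[OF coaction_spaces(3) _ _ _ _ idt_block])
     (auto simp: g tmap_single homC_MM[OF f])

lemma Dr_inner:
  assumes hs: "\<forall>h\<in>set hs. letter_hom h"
  shows "tmap ([idt] @ hs) (tmap [idt, onC f] (Dr m)) = tmap [idt, onC (\<lambda>c. tmap hs (f c))] (Dr m)"
  by (rule tmap_blocks_eq[OF coaction_spaces(3) _ _ _ _ idt_block])
     (use hs in \<open>auto simp: tmap_single onC_tmap letter_hom_tmap\<close>)

lemma Dl_outer: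
  assumes g: "letter_hom g"
  shows "tmap (replicate n idt @ [g]) (tmap [onC f, idt] (Dl m)) = tmap [onC f, g] (Dl m)"
  by (rule tmap_blocks_eq[OF coaction_spaces(2), where Bs = "replicate n MM"])
     (auto simp: g tmap_single homC_MM[OF f])

lemma Dl_inner:
  assumes hs: "\<forall>h\<in>set hs. letter_hom h" "length hs = n"
  shows "tmap (hs @ [idt]) (tmap [onC f, idt] (Dl m)) = tmap [onC (\<lambda>c. tmap hs (f c)), idt] (Dl m)"
  by (rule tmap_blocks_eq[OF coaction_spaces(2), where Bs = "replicate n MM"])
     (use hs homC_MM(1)[OF f] in \<open>auto simp: tmap_single onC_tmap letter_hom_tmap\<close>)

text \<open>
  Coassociativity of the right and of the left coaction turns these summands of \<open>\<delta>\<^sub>c (\<Theta> f)\<close>, two in the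
  first and two in the last component, into the summands of \<open>\<Theta> (\<delta> f)\<close> that contain \<open>(T \<otimes> f) \<triangle>\<close> or
  \<open>(f \<otimes> T) \<triangle>\<close>.
\<close>

lemma Dr_prec:
  "tmap ([onM prec] @ replicate n idt) (tmap [idt, onC f] (Dr m)) =
    tmap [idt, onC (\<lambda>c. tmap [map_letter T, onC f] (Delta c))] (Dr m)"
  unfolding Dr_outer[OF letter_homs_dend(1)] unfolding onM_prec onC_tmap
  by (rule sweedler_r) auto

lemma prec_theta_r:
  "tmap [onM (\<lambda>m. tmap [idt, onC f] (Dr m)), idt] (prec m) =
    tmap [idt, onC (\<lambda>c. tmap [onC f, map_letter T] (Delta c))] (Dr m)"
  unfolding onM_tmap onC_tmap
  by (subst prec_left) (auto simp: letter_hom_tmap intro!: sweedler_r)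

lemma Dl_succ:
  "tmap (replicate n idt @ [onM succ]) (tmap [onC f, idt] (Dl m)) =
    tmap [onC (\<lambda>c. tmap [onC f, map_letter T] (Delta c)), idt] (Dl m)"
  unfolding Dl_outer[OF letter_homs_dend(2)] unfolding onM_succ onC_tmap
  by (rule sweedler_l[symmetric]) auto

lemma succ_theta_l:
  "tmap [idt, onM (\<lambda>m. tmap [onC f, idt] (Dl m))] (succ m) =
    tmap [onC (\<lambda>c. tmap [map_letter T, onC f] (Delta c)), idt] (Dl m)"
  unfolding onM_tmap onC_tmap
  by (subst succ_right) (auto simp: letter_hom_tmap intro!: sweedler_l[symmetric])

text \<open>
  The two sides are, up to sign, summands of the same middle component of \<open>\<delta>\<^sub>c (\<Theta> f)\<close>, where they
  cancel.  They agree because the left and the right coaction are compatible.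
\<close>

lemma Dr_succ:
  "tmap ([onM succ] @ replicate n idt) (tmap [idt, onC f] (Dr m)) =
    tmap [idt, onM (\<lambda>m. tmap [idt, onC f] (Dr m))] (succ m)"
  unfolding Dr_outer[OF letter_homs_dend(2)] unfolding onM_succ onM_tmap
  by (subst succ_right) (auto simp: letter_hom_tmap intro!: sweedler_lr)

lemma Dl_prec:
  "tmap (replicate n idt @ [onM prec]) (tmap [onC f, idt] (Dl m)) =
    tmap [onM (\<lambda>m. tmap [onC f, idt] (Dl m)), idt] (prec m)"
  unfolding Dl_outer[OF letter_homs_dend(1)] unfolding onM_prec onM_tmap
  by (subst prec_left) (auto simp: letter_hom_tmap intro!: sweedler_lr[symmetric])

text \<open>
  In this form \<open>delta n f\<close> is a linear combination of maps on letters, so that the bilinearity of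
  \<open>tmap [g, h] t\<close> applies to it.
\<close>

lemma delta_decomposition:
  "onC (delta n f) = (\<lambda>x.
     onC (\<lambda>c. tmap [map_letter T, onC f] (Delta c)) x
     + tscale (-1) (onC (\<lambda>c. tmap [idt, onC f] (Dr (T c))) x)
     + (\<Sum>i=1..n. tscale ((-1) ^ i)
         (onC (\<lambda>c. tmap (dend_at n i) (f c)) x))
     + tscale ((-1) ^ (n + 1)) (onC (\<lambda>c. tmap [onC f, map_letter T] (Delta c)) x)
     + tscale (- ((-1) ^ (n + 1))) (onC (\<lambda>c. tmap [onC f, idt] (Dl (T c))) x))"
proof -
  have diff: "u - v = u + tscale (-1) v" for u v :: "('k, 'c, 'm) tensor"
    by (simp add: fun_eq_iff pointwise)
  show ?thesis
    unfolding delta_def diff Delta_left[OF f_hom] Delta_right[OF f_hom] onC_add onC_scale onC_sum dend_at_def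
    by (simp only: tscale_tscale mult_minus1)
qed

lemma delta_parts_hom:
  "letter_hom (onC (\<lambda>c. tmap [map_letter T, onC f] (Delta c)))"
  "letter_hom (onC (\<lambda>c. tmap [idt, onC f] (Dr (T c))))"
  "letter_hom (onC (\<lambda>c. tmap (dend_at n i) (f c)))"
  "letter_hom (onC (\<lambda>c. tmap [onC f, map_letter T] (Delta c)))"
  "letter_hom (onC (\<lambda>c. tmap [onC f, idt] (Dl (T c))))"
proof -
  have "letter_hom (onC (\<lambda>c. Dr (T c)))" "letter_hom (onC (\<lambda>c. Dl (T c)))"
    by (simp_all add: comp_T_hom)
  then show "letter_hom (onC (\<lambda>c. tmap [map_letter T, onC f] (Delta c)))"
    "letter_hom (onC (\<lambda>c. tmap [idt, onC f] (Dr (T c))))"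
    "letter_hom (onC (\<lambda>c. tmap (dend_at n i) (f c)))"
    "letter_hom (onC (\<lambda>c. tmap [onC f, map_letter T] (Delta c)))"
    "letter_hom (onC (\<lambda>c. tmap [onC f, idt] (Dl (T c))))"
    unfolding onC_tmap by (auto intro!: letter_hom_tmap simp: dend_at_hom)
qed

lemma delta_hom: "letter_hom (onC (delta n f))"
  unfolding delta_decomposition
  by (intro delta_parts_hom letter_hom_add letter_hom_scale letter_hom_sum)

lemma tmap_delta_right:
  assumes t: "t \<in> Tens" and h: "letter_hom h"
  shows "tmap [h, onC (delta n f)] t =
     tmap [h, onC (\<lambda>c. tmap [map_letter T, onC f] (Delta c))] t
     + tscale (-1) (tmap [h, onC (\<lambda>c. tmap [idt, onC f] (Dr (T c)))] t)
     + (\<Sum>i=1..n. tscale ((-1) ^ i) (tmap [h, onC (\<lambda>c. tmap (dend_at n i) (f c))] t))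
     + tscale ((-1) ^ (n + 1)) (tmap [h, onC (\<lambda>c. tmap [onC f, map_letter T] (Delta c))] t)
     + tscale (- ((-1) ^ (n + 1))) (tmap [h, onC (\<lambda>c. tmap [onC f, idt] (Dl (T c)))] t)"
  unfolding delta_decomposition
  by (simp only: tmap_pair_add[OF t _ _ h] tmap_pair_scale[OF t _ h] tmap_pair_sum[OF t _ h]
      delta_parts_hom letter_hom_add letter_hom_scale letter_hom_sum)

lemma tmap_delta_left:
  assumes t: "t \<in> Tens" and h: "letter_hom h"
  shows "tmap [onC (delta n f), h] t =
     tmap [onC (\<lambda>c. tmap [map_letter T, onC f] (Delta c)), h] t
     + tscale (-1) (tmap [onC (\<lambda>c. tmap [idt, onC f] (Dr (T c))), h] t)
     + (\<Sum>i=1..n. tscale ((-1) ^ i) (tmap [onC (\<lambda>c. tmap (dend_at n i) (f c)), h] t))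
     + tscale ((-1) ^ (n + 1)) (tmap [onC (\<lambda>c. tmap [onC f, map_letter T] (Delta c)), h] t)
     + tscale (- ((-1) ^ (n + 1))) (tmap [onC (\<lambda>c. tmap [onC f, idt] (Dl (T c))), h] t)"
  unfolding delta_decomposition
  by (simp only: tmap_pair_add[OF t _ _ h] tmap_pair_scale[OF t _ h] tmap_pair_sum[OF t _ h]
      delta_parts_hom letter_hom_add letter_hom_scale letter_hom_sum)

lemma theta_hom:
  "letter_hom (onM (\<lambda>m. tmap [idt, onC f] (Dr m)))" "letter_hom (onM (\<lambda>m. tmap [onC f, idt] (Dl m)))"
  unfolding onM_tmap by (auto intro!: letter_hom_tmap)

text \<open>
  For \<open>n = 0\<close> the component \<open>[1]\<close> would be the first and the last one at once.
\<close>

lemma sum_Theta: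
  assumes "0 < n"
  shows "at_vec (Theta n f) (\<Sum>j=1..n+1. bas j) =
    (\<lambda>m. tscale ((-1) ^ (n + 1)) (tmap [idt, onC f] (Dr m)) + tmap [onC f, idt] (Dl m))"
proof -
  have "(\<Sum>j=1..n+1. Theta n f j m) = (\<Sum>j\<in>{1, n+1}. Theta n f j m)" for m
    by (rule sum.mono_neutral_right) (auto simp: Theta_def)
  then show ?thesis
    unfolding at_vec_sum_bas using assms by (simp add: Theta_def)
qed

lemma sum_comult: "at_vec comult (\<Sum>j=1..2. bas j) = (\<lambda>m. prec m + succ m)"
  unfolding at_vec_sum_bas by (simp add: comult_def numeral_2_eq_2)

lemma delta_c_Theta_first:
  assumes n: "0 < n"
  shows "delta_c (n + 1) (Theta n f) 1 m = Theta (n + 1) (delta n f) 1 m"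
proof -
  let ?s = "(-1) ^ (n + 1) :: 'k"
  let ?term = "\<lambda>i. tscale ((-1) ^ i)
    (tmap (replicate (i - 1) idt @ [onM (at_vec comult (R1 (n + 1) i 2 1))] @ replicate (n + 1 - i) idt)
      (Theta n f (R0 (n + 1) i 2 1) m))"
  \<comment> \<open>the five summands of \<open>delta n f\<close>, without sign, in the second factor of \<open>Dr m\<close>\<close>
  define q1 where "q1 = tmap [idt, onC (\<lambda>c. tmap [map_letter T, onC f] (Delta c))] (Dr m)"
  define q2 where "q2 = tmap [idt, onC (\<lambda>c. tmap [idt, onC f] (Dr (T c)))] (Dr m)"
  define q3 where "q3 = (\<Sum>i=1..n. tscale ((-1) ^ i) (tmap [idt, onC (\<lambda>c. tmap (dend_at n i) (f c))] (Dr m)))"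
  define q4 where "q4 = tmap [idt, onC (\<lambda>c. tmap [onC f, map_letter T] (Delta c))] (Dr m)"
  define q5 where "q5 = tmap [idt, onC (\<lambda>c. tmap [onC f, idt] (Dl (T c)))] (Dr m)"
  have R: "R0 2 2 (n + 1) 1 = 1" "R1 2 2 (n + 1) 1 = (\<Sum>j=1..n+1. bas j :: nat \<Rightarrow>\<^sub>0 'k)"
    "R0 2 1 (n + 1) 1 = 1" "R1 2 1 (n + 1) 1 = (bas 1 :: nat \<Rightarrow>\<^sub>0 'k)"
    "R0 (n + 1) 1 2 1 = 1" "R0 (n + 1) (Suc i) 2 1 = 1" "R1 (n + 1) 1 2 1 = (bas 1 :: nat \<Rightarrow>\<^sub>0 'k)"
    "R1 (n + 1) (Suc (Suc i)) 2 1 = (\<Sum>j=1..2. bas j :: nat \<Rightarrow>\<^sub>0 'k)" for i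
    by (simp_all add: R0_def R1_def)
  have c1: "comult 1 = prec" by (simp add: comult_def)
  have Th1: "Theta n f 1 = (\<lambda>m. tscale ?s (tmap [idt, onC f] (Dr m)))"
    by (simp add: Theta_def)
  have first: "tmap [idt, onM (at_vec (Theta n f) (R1 2 2 (n + 1) 1))] (comult (R0 2 2 (n + 1) 1) m)
      = tscale ?s q2 + q5"
    unfolding R sum_Theta[OF n] c1 onM_add onM_scale q2_def q5_def
      prec_right[OF theta_hom(1), symmetric] prec_right[OF theta_hom(2), symmetric]
    by (simp only: tmap_pair_add tmap_pair_scale coaction_Tens theta_hom letter_hom_scale letter_homs)
  have last: "tmap [onM (at_vec (Theta n f) (R1 2 1 (n + 1) 1)), idt] (comult (R0 2 1 (n + 1) 1) m)
      = tscale ?s q4"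
    unfolding R at_vec_bas c1 Th1 onM_scale q4_def prec_theta_r[symmetric]
    by (simp only: tmap_pair_scale coaction_Tens theta_hom letter_homs)
  \<comment> \<open>The first factor of \<open>f\<^sub>r\<close> is the one from \<open>Dr\<close>; the others come from \<open>f\<close>, which shifts \<open>i\<close> by one.\<close>
  have "(\<Sum>i=1..n+1. ?term i)
      = tscale (-1) (tmap ([onM prec] @ replicate n idt) (tscale ?s (tmap [idt, onC f] (Dr m))))
        + (\<Sum>i=1..n. tscale ((-1) ^ Suc i)
            (tmap (replicate i idt @ [onM (at_vec comult (R1 (n + 1) (Suc i) 2 1))] @ replicate (n - i) idt)
              (tscale ?s (tmap [idt, onC f] (Dr m)))))"
    unfolding sum_first R(5-7) Th1 at_vec_bas c1
    by (simp only: power_one_right diff_self_eq_0 replicate_0 append_Nil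
        add_diff_cancel_right' diff_Suc_1 Suc_eq_plus1[symmetric] diff_Suc_Suc)
  also have "(\<Sum>i=1..n. tscale ((-1) ^ Suc i)
            (tmap (replicate i idt @ [onM (at_vec comult (R1 (n + 1) (Suc i) 2 1))] @ replicate (n - i) idt)
              (tscale ?s (tmap [idt, onC f] (Dr m))))) = tscale (- ?s) q3"
    unfolding q3_def
  proof (subst tscale_sum, rule sum.cong[OF refl])
    fix i assume i: "i \<in> {1..n}"
    then obtain j where j: "i = Suc j" by (cases i) auto
    have "replicate i idt @ [onM (at_vec comult (R1 (n + 1) (Suc i) 2 1))] @ replicate (n - i) idt = [idt] @ dend_at n i"
      unfolding j R(8) sum_comult dend_at_def by simp
    then show "tscale ((-1) ^ Suc i)
            (tmap (replicate i idt @ [onM (at_vec comult (R1 (n + 1) (Suc i) 2 1))] @ replicate (n - i) idt)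
              (tscale ?s (tmap [idt, onC f] (Dr m)))) =
        tscale (- ?s) (tscale ((-1) ^ i) (tmap [idt, onC (\<lambda>c. tmap (dend_at n i) (f c))] (Dr m)))"
      using Dr_inner[OF dend_at_hom, of n i m] by (simp add: tmap_linear tscale_tscale mult.commute)
  qed
  finally have middle: "(\<Sum>i=1..n+1. ?term i)
      = tscale (-1) (tscale ?s q1) + tscale (- ?s) q3"
    unfolding tmap_linear Dr_prec q1_def .
  have "1 \<in> {1..n + 1 + 1}" by simp
  then have lhs: "delta_c (n + 1) (Theta n f) 1 m =
      tscale ?s q2 + q5 + (tscale (-1) (tscale ?s q1) + tscale (- ?s) q3)
      + tscale ((-1) ^ (n + 1 + 1)) (tscale ?s q4)"
    unfolding delta_c_def first last middle by (simp only: if_True)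
  have rhs: "Theta (n + 1) (delta n f) 1 m =
      tscale ((-1) ^ (n + 1 + 1)) (q1 + tscale (-1) q2 + q3 + tscale ?s q4 + tscale (- ?s) q5)"
    unfolding Theta_def tmap_delta_right[OF coaction_Tens(3) letter_homs(1)] q1_def q2_def q3_def q4_def q5_def
    by (simp only: if_True refl)
  show ?thesis
    unfolding lhs rhs by (simp add: fun_eq_iff pointwise algebra_simps)
qed

lemma delta_c_Theta_last:
  assumes n: "0 < n"
  shows "delta_c (n + 1) (Theta n f) (n + 2) m = Theta (n + 1) (delta n f) (n + 2) m"
proof -
  let ?s = "(-1) ^ (n + 1) :: 'k"
  let ?term = "\<lambda>i. tscale ((-1) ^ i)
    (tmap (replicate (i - 1) idt @ [onM (at_vec comult (R1 (n + 1) i 2 (n + 2)))] @ replicate (n + 1 - i) idt)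
      (Theta n f (R0 (n + 1) i 2 (n + 2)) m))"
  \<comment> \<open>the five summands of \<open>delta n f\<close>, without sign, in the first factor of \<open>Dl m\<close>\<close>
  define q1 where "q1 = tmap [onC (\<lambda>c. tmap [map_letter T, onC f] (Delta c)), idt] (Dl m)"
  define q2 where "q2 = tmap [onC (\<lambda>c. tmap [idt, onC f] (Dr (T c))), idt] (Dl m)"
  define q3 where "q3 = (\<Sum>i=1..n. tscale ((-1) ^ i) (tmap [onC (\<lambda>c. tmap (dend_at n i) (f c)), idt] (Dl m)))"
  define q4 where "q4 = tmap [onC (\<lambda>c. tmap [onC f, map_letter T] (Delta c)), idt] (Dl m)"
  define q5 where "q5 = tmap [onC (\<lambda>c. tmap [onC f, idt] (Dl (T c))), idt] (Dl m)"
  have R: "R0 2 2 (n + 1) (n + 2) = 2" "R1 2 2 (n + 1) (n + 2) = (bas (n + 1) :: nat \<Rightarrow>\<^sub>0 'k)"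
    "R0 2 1 (n + 1) (n + 2) = 2" "R1 2 1 (n + 1) (n + 2) = (\<Sum>j=1..n+1. bas j :: nat \<Rightarrow>\<^sub>0 'k)"
    "R0 (n + 1) (n + 1) 2 (n + 2) = n + 1" "R1 (n + 1) (n + 1) 2 (n + 2) = (bas 2 :: nat \<Rightarrow>\<^sub>0 'k)"
    by (simp_all add: R0_def R1_def numeral_2_eq_2)
  have Ri: "R0 (n + 1) i 2 (n + 2) = n + 1" "R1 (n + 1) i 2 (n + 2) = (\<Sum>j=1..2. bas j :: nat \<Rightarrow>\<^sub>0 'k)"
    if "i \<in> {1..n}" for i
    using that by (auto simp: R0_def R1_def)
  have c2: "comult 2 = succ" by (simp add: comult_def)
  have Thn: "Theta n f (n + 1) = (\<lambda>m. tmap [onC f, idt] (Dl m))"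
    using n by (simp add: Theta_def)
  have first: "tmap [idt, onM (at_vec (Theta n f) (R1 2 2 (n + 1) (n + 2)))] (comult (R0 2 2 (n + 1) (n + 2)) m)
      = q1"
    unfolding R at_vec_bas c2 Thn succ_theta_l q1_def ..
  have last: "tmap [onM (at_vec (Theta n f) (R1 2 1 (n + 1) (n + 2))), idt] (comult (R0 2 1 (n + 1) (n + 2)) m)
      = tscale ?s q2 + q5"
    unfolding R sum_Theta[OF n] c2 onM_add onM_scale q2_def q5_def
      succ_left[OF theta_hom(1), symmetric] succ_left[OF theta_hom(2), symmetric]
    by (simp only: tmap_pair_add tmap_pair_scale coaction_Tens theta_hom letter_hom_scale letter_homs)
  \<comment> \<open>The last factor of \<open>f\<^sub>l\<close> is the one from \<open>Dl\<close>; the others come from \<open>f\<close>, with the same \<open>i\<close>.\<close>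
  have "(\<Sum>i=1..n+1. ?term i)
      = (\<Sum>i=1..n. ?term i)
        + tscale ?s (tmap (replicate n idt @ [onM succ]) (tmap [onC f, idt] (Dl m)))"
    unfolding sum_last R Thn at_vec_bas c2
    by (simp only: diff_self_eq_0 replicate_0 append_Nil2 add_diff_cancel_right')
  also have "(\<Sum>i=1..n. ?term i) = q3"
    unfolding q3_def
  proof (rule sum.cong[OF refl])
    fix i assume i: "i \<in> {1..n}"
    have "replicate (n + 1 - i) idt = replicate (n - i) idt @ [idt]"
      using i by (simp add: Suc_diff_le replicate_append_same)
    then have "replicate (i - 1) idt @ [onM (at_vec comult (R1 (n + 1) i 2 (n + 2)))] @ replicate (n + 1 - i) idt = dend_at n i @ [idt]"
      unfolding Ri[OF i] sum_comult dend_at_def by simp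
    then show "?term i =
        tscale ((-1) ^ i) (tmap [onC (\<lambda>c. tmap (dend_at n i) (f c)), idt] (Dl m))"
      using Dl_inner[OF dend_at_hom, of n i m] i unfolding Ri(1)[OF i] Thn by (simp add: dend_at_def)
  qed
  finally have middle: "(\<Sum>i=1..n+1. ?term i)
      = q3 + tscale ?s q4"
    unfolding Dl_succ q4_def .
  have r: "n + 2 \<in> {1..n + 1 + 1}" "n + 2 \<noteq> 1" "n + 2 = n + 1 + 1" by simp_all
  then have lhs: "delta_c (n + 1) (Theta n f) (n + 2) m =
      q1 + (q3 + tscale ?s q4) + tscale ((-1) ^ (n + 1 + 1)) (tscale ?s q2 + q5)"
    unfolding delta_c_def first last middle by (simp only: if_True)
  have rhs: "Theta (n + 1) (delta n f) (n + 2) m =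
      q1 + tscale (-1) q2 + q3 + tscale ?s q4 + tscale (- ?s) q5"
    unfolding Theta_def tmap_delta_left[OF coaction_Tens(2) letter_homs(1)] q1_def q2_def q3_def q4_def q5_def
    by (simp only: r(3) if_True if_False refl r(2)[unfolded r(3)])
  show ?thesis
    unfolding lhs rhs by (simp add: fun_eq_iff pointwise algebra_simps)
qed

lemma delta_c_Theta_middle:
  assumes n: "0 < n" and r: "2 \<le> r" "r \<le> n + 1"
  shows "delta_c (n + 1) (Theta n f) r m = 0"
proof -
  let ?s = "(-1) ^ (n + 1) :: 'k"
  \<comment> \<open>\<open>X\<close> occurs for \<open>r = 2\<close> and \<open>Y\<close> for \<open>r = n + 1\<close>, each twice and with opposite signs.\<close>
  define X where "X = tscale ?s (tmap [idt, onM (\<lambda>m. tmap [idt, onC f] (Dr m))] (succ m))"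
  define Y where "Y = tscale ?s (tmap [onM (\<lambda>m. tmap [onC f, idt] (Dl m)), idt] (prec m))"
  have onM_0: "onM (\<lambda>m. 0) = (\<lambda>x. 0)" by (auto simp: onM_def fun_eq_iff split: sum.splits)
  have pair_0: "tmap [\<lambda>x. 0, idt] t = 0" "tmap [idt, \<lambda>x. 0] t = 0" if "t \<in> Tens" for t
    using tmap_pair_sum[OF that, of "{}" "\<lambda>_. idt" idt] by simp_all
  have first: "tmap [idt, onM (at_vec (Theta n f) (R1 2 2 (n + 1) r))] (comult (R0 2 2 (n + 1) r) m)
      = (if r = 2 then X else 0)"
  proof -
    have "r - 2 + 1 = r - 1" using r by simp
    then have "R0 2 2 (n + 1) r = 2" "R1 2 2 (n + 1) r = (bas (r - 1) :: nat \<Rightarrow>\<^sub>0 'k)" "comult 2 = succ"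
      using r by (simp_all add: R0_def R1_def comult_def del: One_nat_def add_Suc_right)
    moreover have "Theta n f (r - 1) = (if r = 2 then (\<lambda>m. tscale ?s (tmap [idt, onC f] (Dr m))) else (\<lambda>m. 0))"
    proof -
      have "r - 1 = 1 \<longleftrightarrow> r = 2" "r - 1 \<noteq> n + 1" using r by auto
      then show ?thesis unfolding Theta_def by (simp only: if_False) simp
    qed
    ultimately show ?thesis
      by (simp only: at_vec_bas)
        (simp add: X_def onM_0 pair_0 onM_scale tmap_pair_scale theta_hom)
  qed
  have last: "tscale ((-1) ^ (n + 1 + 1)) (tmap [onM (at_vec (Theta n f) (R1 2 1 (n + 1) r)), idt] (comult (R0 2 1 (n + 1) r) m))
      = (if r = n + 1 then tscale (-1) Y else 0)"
  proof -
    have "R0 2 1 (n + 1) r = 1" "R1 2 1 (n + 1) r = (bas r :: nat \<Rightarrow>\<^sub>0 'k)" "comult 1 = prec"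
      using r by (auto simp: R0_def R1_def comult_def)
    moreover have "Theta n f r = (if r = n + 1 then (\<lambda>m. tmap [onC f, idt] (Dl m)) else (\<lambda>m. 0))"
      using r by (auto simp: Theta_def)
    ultimately show ?thesis
      by (simp only: at_vec_bas)
        (simp add: Y_def onM_0 pair_0 tscale_tscale)
  qed
  \<comment> \<open>\<open>R0 (n + 1) i 2\<close> takes \<open>r\<close> to an end of \<open>1, \<dots>, n + 1\<close> only in the first and the last summand.\<close>
  have term_i: "tscale ((-1) ^ i)
      (tmap (replicate (i - 1) idt @ [onM (at_vec comult (R1 (n + 1) i 2 r))] @ replicate (n + 1 - i) idt)
        (Theta n f (R0 (n + 1) i 2 r) m))
    = (if i = 1 then (if r = 2 then tscale (-1) X else 0) else 0)
      + (if i = n + 1 then (if r = n + 1 then Y else 0) else 0)" if i: "i \<in> {1..n+1}" for i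
  proof -
    consider "i = 1" "r = 2" | "i = n + 1" "r = n + 1" | "\<not> (i = 1 \<and> r = 2)" "\<not> (i = n + 1 \<and> r = n + 1)"
      by blast
    then show ?thesis
    proof cases
      case 1
      then have "R0 (n + 1) i 2 r = 1" "R1 (n + 1) i 2 r = (bas 2 :: nat \<Rightarrow>\<^sub>0 'k)" "comult 2 = succ"
        "Theta n f 1 = (\<lambda>m. tscale ?s (tmap [idt, onC f] (Dr m)))"
        by (auto simp: R0_def R1_def comult_def Theta_def numeral_2_eq_2)
      then show ?thesis
        using 1 n Dr_succ[of m] by (simp only: at_vec_bas) (simp add: X_def tmap_linear)
    next
      case 2
      then have "R0 (n + 1) i 2 r = n + 1" "R1 (n + 1) i 2 r = (bas 1 :: nat \<Rightarrow>\<^sub>0 'k)" "comult 1 = prec"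
        "Theta n f (n + 1) = (\<lambda>m. tmap [onC f, idt] (Dl m))"
        using n by (auto simp: R0_def R1_def comult_def Theta_def)
      then show ?thesis
        using 2 n Dl_prec[of m] by (simp only: at_vec_bas) (simp add: Y_def)
    next
      case 3
      have "R0 (n + 1) i 2 r \<noteq> 1" "R0 (n + 1) i 2 r \<noteq> n + 1"
        using 3 i r by (auto simp: R0_def split: if_splits)
      then have "Theta n f (R0 (n + 1) i 2 r) m = 0"
        by (simp add: Theta_def)
      then show ?thesis using 3 by (auto simp: tmap_linear)
    qed
  qed
  have "(\<Sum>i=1..n+1. tscale ((-1) ^ i)
      (tmap (replicate (i - 1) idt @ [onM (at_vec comult (R1 (n + 1) i 2 r))] @ replicate (n + 1 - i) idt)
        (Theta n f (R0 (n + 1) i 2 r) m)))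
    = (\<Sum>i=1..n+1. (if i = 1 then (if r = 2 then tscale (-1) X else 0) else 0)
      + (if i = n + 1 then (if r = n + 1 then Y else 0) else 0))"
    by (rule sum.cong[OF refl term_i])
  also have "\<dots> = (if r = 2 then tscale (-1) X else 0) + (if r = n + 1 then Y else 0)"
    unfolding sum.distrib by (subst (1 2) sum.delta) simp_all
  finally show ?thesis
    unfolding delta_c_def first last using r by (auto simp: fun_eq_iff pointwise)
qed

theorem delta_c_Theta:
  assumes n: "0 < n"
  shows "delta_c (n + 1) (Theta n f) = Theta (n + 1) (delta n f)"
proof (intro ext)
  fix r m \<psi>
  consider "r = 1" | "r = n + 2" | "2 \<le> r" "r \<le> n + 1" | "r = 0 \<or> n + 2 < r" by linarith
  then have "delta_c (n + 1) (Theta n f) r m = Theta (n + 1) (delta n f) r m"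
  proof cases
    case 1
    then show ?thesis using delta_c_Theta_first[OF n] by simp
  next
    case 2
    then show ?thesis using delta_c_Theta_last[OF n] by simp
  next
    case 3
    then show ?thesis using delta_c_Theta_middle[OF n 3] by (simp add: Theta_def)
  next
    case 4
    then have "r \<notin> {1..n+1+1}" "r \<noteq> 1" "r \<noteq> n + 1 + 1" by auto
    then show ?thesis unfolding delta_c_def Theta_def by (simp only: if_False)
  qed
  then show "delta_c (n + 1) (Theta n f) r m \<psi> = Theta (n + 1) (delta n f) r m \<psi>" by simp
qed

end

section \<open>The induced morphism\<close>

lemma T_cochains_subset: "T_cochains n \<subseteq> homC (replicate n MM)"
  by (auto simp: T_cochains_def homC_closed)

lemma onC_fun_add: "onC (f + g) = (\<lambda>x. onC f x + onC g x)"
  using onC_add[of f g] by (simp add: plus_fun_apply[abs_def] plus_fun_def)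

lemma onC_fun_scale: "onC (pscale tscale k f) = (\<lambda>x. tscale k (onC f x))"
  using onC_scale[of k f] by (simp add: pscale_def[of tscale])

lemma linear_differentials_T: "linear_differentials (pscale tscale) T_cochains d_T"
proof -
  let ?s = "pscale tscale :: 'k \<Rightarrow> ('c \<Rightarrow> ('k, 'c, 'm) tensor) \<Rightarrow> _"
  interpret V: vector_space ?s
    by (intro vector_space_pscale vector_space_field)
  show ?thesis
  proof
    fix n
    show "V.subspace (T_cochains n)"
      unfolding V.subspace_def T_cochains_def by (auto simp: homC_closed)
  next
    fix f g n assume "f \<in> T_cochains n" "g \<in> T_cochains n"
    then have lh: "letter_hom (onC f)" "letter_hom (onC g)"
      using T_cochains_subset letter_hom_intros(2) by blast+
    have "delta n (f + g) c = delta n f c + delta n g c" for c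
      unfolding delta_def onC_fun_add
      by (simp add: tmap_pair_add tmap_linear tmap_Tens lh plus_fun_apply[of f] sum.distrib algebra_simps)
    then show "d_T n (f + g) = d_T n f + d_T n g"
      by (simp add: d_T_def fun_eq_iff pointwise algebra_simps)
  next
    fix f n k assume "f \<in> T_cochains n"
    then have lh: "letter_hom (onC f)"
      using T_cochains_subset letter_hom_intros(2) by blast
    have diff: "u - v = u + tscale (-1) v" for u v :: "('k, 'c, 'm) tensor"
      by (simp add: fun_eq_iff pointwise)
    have "delta n (?s k f) c = tscale k (delta n f c)" for c
      unfolding delta_def onC_fun_scale diff
      by (simp add: tmap_pair_scale tmap_linear tmap_Tens lh pscale_apply[of tscale] tscale_sum tscale_commute)
    then show "d_T n (?s k f) = ?s k (d_T n f)"
      by (simp add: d_T_def fun_eq_iff pointwise mult.left_commute)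
  qed
qed

lemma Theta_mem:
  assumes "f \<in> T_cochains n"
  shows "Theta n f \<in> coDend_cochains (n + 1)"
proof -
  have f: "f \<in> homC (replicate n MM)" using assms T_cochains_subset by blast
  have 1: "(\<lambda>m. tmap [idt, onC f] (Dr m)) \<in> homM ([MM] @ replicate n MM)"
    by (rule tmap_pair_homM[OF coaction_spaces(3)])
       (auto simp: f_hom[OF f] homC_MM[OF f] idt_def set_Cons_def intro!: tprod_in_tensor_space)
  have 2: "(\<lambda>m. tmap [onC f, idt] (Dl m)) \<in> homM (replicate n MM @ [MM])"
    by (rule tmap_pair_homM[OF coaction_spaces(2)])
       (auto simp: f_hom[OF f] homC_MM[OF f] idt_def set_Cons_def intro!: tprod_in_tensor_space)
  have 3: "(\<lambda>m. tscale k (tmap [idt, onC f] (Dr m))) \<in> homM (replicate (n + 1) MM)" for k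
    using homM_closed(3)[OF 1, of k] by (simp add: pscale_def[of tscale])
  have 4: "(\<lambda>m. tmap [onC f, idt] (Dl m)) \<in> homM (replicate (n + 1) MM)"
    using 2 by (simp add: replicate_append_same)
  have 5: "(\<lambda>m. 0) \<in> homM (replicate (n + 1) MM)"
    using homM_closed(1) by (simp add: zero_fun_def)
  have "Theta n f r = (if r = 1 then (\<lambda>m. tscale ((-1) ^ (n + 1)) (tmap [idt, onC f] (Dr m)))
      else if r = n + 1 then (\<lambda>m. tmap [onC f, idt] (Dl m)) else (\<lambda>m. 0))" for r
    by (simp add: Theta_def)
  then show ?thesis
    unfolding coDend_cochains_def using 3 4 5 by auto
qed

lemma Theta_add:
  assumes "letter_hom (onC f)" "letter_hom (onC g)"
  shows "Theta n (f + g) = Theta n f + Theta n g"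
proof -
  have "Theta n (f + g) r m = Theta n f r m + Theta n g r m" for r m
    unfolding Theta_def onC_fun_add by (simp add: tmap_pair_add assms)
  then show ?thesis by (simp add: fun_eq_iff pointwise)
qed

lemma Theta_scale:
  assumes "letter_hom (onC f)"
  shows "Theta n (pscale tscale k f) = pscale (pscale tscale) k (Theta n f)"
proof -
  have "Theta n (pscale tscale k f) r m = tscale k (Theta n f r m)" for r m
    unfolding Theta_def onC_fun_scale by (simp add: tmap_pair_scale assms tscale_commute)
  then show ?thesis by (simp add: fun_eq_iff pointwise)
qed

text \<open>
  In degree \<open>0\<close>, where \<open>delta_c_Theta\<close> does not apply, the complex is zero and both sides vanish.
\<close>

lemma Theta_d_T:
  assumes f: "f \<in> T_cochains n"
  shows "Theta (Suc n) (d_T n f) = pscale (pscale tscale) ((-1) ^ n) (delta_c (n + 1) (Theta n f))"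
proof (cases "n = 0")
  case True
  interpret A: linear_differentials "pscale tscale" T_cochains d_T
    by (rule linear_differentials_T)
  interpret A': linear_differentials "pscale (pscale tscale)" coDend_cochains delta_c
    by (rule linear_differentials_coDend)
  have "letter_hom (onC 0)" using letter_hom_intros(2)[OF homC_closed(1)] .
  then have "Theta n 0 = 0" for n
    using Theta_scale[of 0 n 0] by simp
  then show ?thesis
    using f True by (simp add: T_cochains_def A.d_zero A'.d_zero)
next
  case False
  then show ?thesis
    using f T_cochains_subset[of n] delta_c_Theta[of f n] delta_hom[of f n]
    by (auto simp: d_T_def Theta_scale)
qed

theorem Theta_induces_morphism:
  "\<exists>Phi. cohomology_morphism 1 (pscale tscale) T_cochains d_T (pscale (pscale tscale)) coDend_cochains delta_c Phi \<and>
    induces_on_cohomology 1 T_cochains d_T coDend_cochains delta_c Theta Phi"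
proof (rule cochain_map_induces_morphism[where \<epsilon> = "\<lambda>n. (-1) ^ n"])
  have lh: "letter_hom (onC f)" if "f \<in> T_cochains n" for f n
    using that T_cochains_subset letter_hom_intros(2) by blast
  show "Theta n (f + g) = Theta n f + Theta n g" if "f \<in> T_cochains n" "g \<in> T_cochains n" for n f g
    using that by (intro Theta_add lh)
  show "Theta n (pscale tscale k f) = pscale (pscale tscale) k (Theta n f)" if "f \<in> T_cochains n" for n k f
    using that by (intro Theta_scale lh)
  show "Theta n f \<in> coDend_cochains (n + 1)" if "f \<in> T_cochains n" for n f
    by (rule Theta_mem[OF that])
qed (simp_all add: linear_differentials_T linear_differentials_coDend Theta_d_T)

end

end

theorem proposition3p11:
  fixes sC :: "'k::field_char_0 \<Rightarrow> 'c::ab_group_add \<Rightarrow> 'c"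
    and sM :: "'k \<Rightarrow> 'm::ab_group_add \<Rightarrow> 'm"
    and Delta :: "'c \<Rightarrow> ('k, 'c, 'm) tensor"
    and Dl Dr :: "'m \<Rightarrow> ('k, 'c, 'm) tensor"
    and T :: "'c \<Rightarrow> 'm"
  assumes "relative_rota_baxter sC sM Delta Dl Dr T"
  defines "prec \<equiv> relative_rota_baxter.prec sC sM Dr T"
    and "succ \<equiv> relative_rota_baxter.succ sC sM Dl T"
  defines "A \<equiv> relative_rota_baxter.T_cochains sC sM"
    and "d \<equiv> relative_rota_baxter.d_T sC sM Delta Dl Dr T"
    and "A' \<equiv> dendriform_coalgebra.coDend_cochains sC sM"
    and "d' \<equiv> dendriform_coalgebra.delta_c sC sM prec succ"
    and "Theta \<equiv> relative_rota_baxter.Theta sC sM Dl Dr"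
  shows "\<exists>Phi. cohomology_morphism 1 (pscale tscale) A d (pscale (pscale tscale)) A' d' Phi \<and>
    induces_on_cohomology 1 A d A' d' Theta Phi"
  unfolding prec_def succ_def A_def d_def A'_def d'_def Theta_def
  by (rule relative_rota_baxter.Theta_induces_morphism[OF assms(1)])

end
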